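(* Let $n>1$ be an integer, let $X$ be an $n$-dimensional topological manifold and let $Y\subset X$ be an $(n-1)$-dimensional submanifold. Then for any connected component $C$ of $X\setminus Y$, the set $\overline{C}\cap Y$ is a union of connected components of $Y$. If moreover $X$ and $Y$ are both connected, then $X\setminus Y$ has at most two connected components.
   Context: Manifolds are topological manifolds (without boundary). An $(n-1)$-dimensional submanifold $Y$ of $X$ is a subset which, with the subspace topology, is an $(n-1)$-dimensional topological manifold; no smoothness, local flatness or closedness in $X$ is assumed. $\overline{C}$ denotes the closure of $C$ in $X$. *)

theory Defs
  imports "HOL-Homology.Homology"
begin

(* Hausdorff and locally Euclidean. Second countability (or paracompactness) is not required, so
   manifolds in the stricter sense are included. Euclidean_space n is R^n, realised as the real
   sequences vanishing from index n on. *)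
definition topological_manifold :: "nat \<Rightarrow> 'a topology \<Rightarrow> bool" where
  "topological_manifold n X \<longleftrightarrow>
     Hausdorff_space X \<and>
     (\<forall>x \<in> topspace X. \<exists>U. openin X U \<and> x \<in> U \<and>
        (subtopology X U) homeomorphic_space (Euclidean_space n))"

definition submanifold :: "nat \<Rightarrow> 'a set \<Rightarrow> 'a topology \<Rightarrow> bool" where
  "submanifold k Y X \<longleftrightarrow> Y \<subseteq> topspace X \<and> topological_manifold k (subtopology X Y)"

end

theory Submission
  imports Defs "HOL-Analysis.Analysis"
begin

text \<open>
  The local statement behind everything: let \<open>U\<close> be a path-connected open subset of \<open>\<real>^(m+1)\<close> and \<open>S\<close>
  relatively closed in \<open>U\<close>, homeomorphic to a closed subset \<open>S'\<close> of \<open>\<real>^m\<close>. The set \<open>S\<close> need not be closed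
  in \<open>\<real>^(m+1)\<close>, but its graph \<open>\<Gamma>\<close> under \<open>1/g\<close>, with \<open>g\<close> the distance to the complement of \<open>U\<close>, is
  closed in \<open>\<real>^(m+2)\<close>. Splitting \<open>(U \<times> \<real>) - \<Gamma>\<close> into the part above and the part below the graph,
  excision and exact sequences exhibit the kernel of \<open>H\<^sub>0(U - S) \<rightarrow> H\<^sub>0(U)\<close> as an image of
  \<open>H\<^sub>2(\<real>^(m+2), \<real>^(m+2) - \<Gamma>)\<close>, which by Alexander duality for closed subsets of Euclidean space depends only
  on \<open>S'\<close> and equals \<open>H\<^sub>0(\<real>^m, \<real>^m - S')\<close>. That group is cyclic, and trivial if \<open>S' \<noteq> \<real>^m\<close>. So a copy of
  \<open>\<real>^m\<close> cuts \<open>U\<close> into at most two pieces and a proper closed subset of it does not cut \<open>U\<close> at all.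

  Globally, if the closure of a component \<open>C\<close> of \<open>X - Y\<close> contained some but not all points of \<open>Y\<close> near \<open>y\<close>,
  then \<open>closure C \<inter> Y\<close> would be a proper closed piece of the hypersurface separating a neighbourhood of \<open>y\<close>;
  hence \<open>closure C \<inter> Y\<close> is open and closed in \<open>Y\<close>. If \<open>X\<close> and \<open>Y\<close> are connected, some component has all of
  \<open>Y\<close> in its closure, a component without this property would be open and closed in \<open>X\<close>, and at most two
  components reach a given point of \<open>Y\<close>.
\<close>

section \<open>Point classes in zeroth homology\<close>

text \<open>The homology class of the singular 0-simplex at \<open>a\<close>.
  \<open>standard_simplex 0\<close> has a single point, and \<open>restrict\<close> makes the
  constant map extensional, as \<open>singular_simplex\<close> demands.\<close>

definition point_class :: "'a topology \<Rightarrow> 'a \<Rightarrow> 'a chain set" where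
  "point_class X a = homologous_rel_set 0 X {} (frag_of (restrict (\<lambda>_. a) (standard_simplex 0)))"

lemma singular_simplex_point:
  "a \<in> topspace X \<Longrightarrow> singular_simplex 0 X (restrict (\<lambda>_. a) (standard_simplex 0))"
  by (simp add: singular_simplex_def)

lemma singular_relcycle_point:
  "a \<in> topspace X \<Longrightarrow> singular_relcycle 0 X {} (frag_of (restrict (\<lambda>_. a) (standard_simplex 0)))"
  by (simp add: singular_relcycle_def singular_chain_of singular_simplex_point chain_boundary_def)

lemma point_class_in_carrier:
  "a \<in> topspace X \<Longrightarrow> point_class X a \<in> carrier (homology_group 0 X)"
  by (auto simp: point_class_def carrier_relative_homology_group_0 singular_relcycle_point)

text \<open>Trivial as soon as a path joins \<open>a\<close> to \<open>b\<close>. These classes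
  stand in for reduced homology when the pieces of \<open>X\<close> are counted.\<close>

definition point_difference :: "'a topology \<Rightarrow> 'a \<Rightarrow> 'a \<Rightarrow> 'a chain set" where
  "point_difference X a b =
     point_class X a \<otimes>\<^bsub>homology_group 0 X\<^esub> inv\<^bsub>homology_group 0 X\<^esub> point_class X b"

lemma hom_induced_point_class:
  assumes "continuous_map X Y f" "a \<in> topspace X"
  shows "hom_induced 0 X {} Y {} f (point_class X a) = point_class Y (f a)"
proof -
  have "hom_induced (int 0) X {} Y {} f (point_class X a) =
        homologous_rel_set 0 Y {} (chain_map 0 f (frag_of (restrict (\<lambda>_. a) (standard_simplex 0))))"
    unfolding point_class_def
    by (rule hom_induced_chain_map) (use assms in \<open>auto simp: singular_relcycle_point\<close>)
  also have "chain_map 0 f (frag_of (restrict (\<lambda>_. a) (standard_simplex 0)))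
      = frag_of (restrict (\<lambda>_. f a) (standard_simplex 0))"
    by (auto simp: chain_map_of simplex_map_def restrict_def intro!: arg_cong [of _ _ frag_of])
  finally show ?thesis
    by (simp add: point_class_def)
qed

lemma point_class_eq:
  assumes "path_connected_space X" "a \<in> topspace X" "b \<in> topspace X"
  shows "point_class X a = point_class X b"
  unfolding point_class_def
  using iso_integer_zeroth_homology_group_aux [OF assms(1) singular_simplex_point singular_simplex_point] assms
  by (simp add: homologous_rel_set_eq)

text \<open>Counting the vertices in \<open>A\<close> is a homomorphism on 0-chains that kills
  boundaries, because the image of a singular 1-simplex is connected and so lies inside the clopen
  set \<open>A\<close> or misses it. Such homomorphisms let integer arithmetic tell open pieces
  apart.\<close>

lemma zeroth_homology_clopen_indicator:
  assumes A: "openin X A" "closedin X A"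
  obtains h where "h \<in> hom (homology_group 0 X) integer_group"
    "\<And>a. a \<in> topspace X \<Longrightarrow> h (point_class X a) = (if a \<in> A then 1 else 0)"
proof -
  \<comment> \<open>\<open>v\<close> is the only point of \<open>standard_simplex 0\<close>. The
    values of \<open>\<tau>\<close> lie in the free abelian group on one generator, since
    \<open>frag_extend\<close> maps into free abelian groups; \<open>\<sigma>\<close> then reads off
    the integer coefficient.\<close>
  define v :: "nat \<Rightarrow> real" where "v = (\<lambda>j. if j = 0 then 1 else 0)"
  define \<tau> :: "((nat \<Rightarrow> real) \<Rightarrow> 'a) \<Rightarrow> unit \<Rightarrow>\<^sub>0 int"
    where "\<tau> = (\<lambda>s. if s v \<in> A then frag_of () else 0)"
  define \<sigma> where "\<sigma> c = Poly_Mapping.lookup (frag_extend \<tau> c) ()" for c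
  have \<sigma>_add: "\<sigma> (c + d) = \<sigma> c + \<sigma> d" for c d
    by (simp add: \<sigma>_def frag_extend_add lookup_add)
  have \<sigma>_diff: "\<sigma> (c - d) = \<sigma> c - \<sigma> d" for c d
    by (simp add: \<sigma>_def frag_extend_diff lookup_minus)
  have face: "\<tau> (singular_face (Suc 0) 0 s) = \<tau> (singular_face (Suc 0) (Suc 0) s)"
    if s: "singular_simplex (Suc 0) X s" for s
  proof -
    have v: "v \<in> standard_simplex 0"
      by (auto simp: v_def standard_simplex_def)
    have 1: "simplical_face i v \<in> standard_simplex (Suc 0)" if "i \<le> Suc 0" for i
      using simplical_face_in_standard_simplex [of "Suc 0" i v] that v by simp
    have "connectedin X (s ` standard_simplex (Suc 0))"
      using s connectedin_continuous_map_image [of "subtopology (powertop_real UNIV) (standard_simplex (Suc 0))" X s]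
        connectedin_standard_simplex [of "Suc 0"]
      by (simp add: singular_simplex_def connectedin_subtopology)
    then have "s ` standard_simplex (Suc 0) \<subseteq> A \<or> disjnt (s ` standard_simplex (Suc 0)) A"
      using A connectedin_clopen_cases by blast
    then have "s (simplical_face 0 v) \<in> A \<longleftrightarrow> s (simplical_face (Suc 0) v) \<in> A"
      using 1 [of 0] 1 [of "Suc 0"] by (auto simp: disjnt_iff image_subset_iff)
    then show ?thesis
      by (simp add: \<tau>_def singular_face_def v)
  qed
  have bd: "frag_extend \<tau> (chain_boundary (Suc 0) d) = 0" if "singular_chain (Suc 0) X d" for d
    using that unfolding singular_chain_def
  proof (induction d rule: frag_induction)
    case (one s)
    then show ?case
      using face [of s] by (simp add: frag_extend_diff chain_boundary_of)
  next
    case (diff a b)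
    then show ?case
      by (simp add: chain_boundary_diff frag_extend_diff)
  qed auto
  have hom: "\<sigma> c = \<sigma> d" if cd: "homologous_rel 0 X {} c d" for c d
  proof -
    obtain e where "singular_chain (Suc 0) X e" "chain_boundary (Suc 0) e = c - d"
      using cd by (auto simp: homologous_rel_def singular_boundary)
    then have "\<sigma> (c - d) = 0"
      using bd unfolding \<sigma>_def by (metis lookup_zero)
    then show ?thesis
      by (simp add: \<sigma>_diff)
  qed
  \<comment> \<open>By \<open>hom\<close>, \<open>\<sigma>\<close> is constant on each homology
    class, and \<open>h\<close> picks that common value.\<close>
  define h where "h R = (THE k. \<sigma> ` R = {k})" for R
  have h: "h (homologous_rel_set 0 X {} c) = \<sigma> c" for c
  proof -
    have "\<sigma> ` homologous_rel_set 0 X {} c = {\<sigma> c}"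
      using hom by (force simp: homologous_rel_refl)
    then show ?thesis
      by (simp add: h_def)
  qed
  show thesis
  proof
    have add: "homologous_rel_set 0 X {} c \<otimes>\<^bsub>homology_group 0 X\<^esub> homologous_rel_set 0 X {} d
        = homologous_rel_set 0 X {} (c + d)"
      if "singular_relcycle 0 X {} c" "singular_relcycle 0 X {} d" for c d
    proof -
      interpret N: normal "singular_relboundary_set 0 X {}" "relcycle_group 0 X {}"
        by (rule normal_subgroup_singular_relboundary_relcycle)
      show ?thesis
        using N.rcos_sum [of c d] that
        by (simp add: nontrivial_relative_homology_group [of 0, simplified] FactGroup_def
            right_coset_singular_relboundary)
    qed
    show "h \<in> hom (homology_group 0 X) integer_group"
      by (auto simp: hom_def carrier_relative_homology_group_0 add h \<sigma>_add)
    show "h (point_class X a) = (if a \<in> A then 1 else 0)" if "a \<in> topspace X" for a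
    proof -
      have "v \<in> standard_simplex 0"
        by (auto simp: v_def standard_simplex_def)
      then show ?thesis
        by (simp add: point_class_def h \<sigma>_def \<tau>_def)
    qed
  qed
qed

text \<open>A composite of three maps: the connecting map of the triple
  \<open>P \<subseteq> P \<union> Q \<subseteq> X\<close>, the inverse of the excision from
  \<open>(Q, P \<inter> Q)\<close> to \<open>(P \<union> Q, P)\<close>, and the boundary map of
  \<open>(Q, P \<inter> Q)\<close>. The first is onto because the next group in the sequence of the
  triple is trivial, the second is an isomorphism, and exactness identifies the image of the third
  with the kernel.\<close>

lemma zeroth_homology_kernel_epimorphic_image:
  assumes P: "openin X P" and Q: "openin X Q"
    and triv: "trivial_group (relative_homology_group 1 X P)"
  obtains \<psi> where
    "\<psi> \<in> hom (relative_homology_group 2 X (P \<union> Q)) (homology_group 0 (subtopology X (P \<inter> Q)))"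
    "\<psi> ` carrier (relative_homology_group 2 X (P \<union> Q)) =
       kernel (homology_group 0 (subtopology X (P \<inter> Q))) (homology_group 0 (subtopology X Q))
         (hom_induced 0 (subtopology X (P \<inter> Q)) {} (subtopology X Q) {} id)"
proof -
  let ?G = "relative_homology_group 2 X (P \<union> Q)"
  let ?H = "relative_homology_group 1 (subtopology X (P \<union> Q)) P"
  let ?K = "relative_homology_group 1 (subtopology X Q) (P \<inter> Q)"
  let ?Z = "homology_group 0 (subtopology X (P \<inter> Q))"
  let ?D = "hom_relboundary 2 X (P \<union> Q) P"
  let ?e = "hom_induced 1 (subtopology X Q) (P \<inter> Q) (subtopology X (P \<union> Q)) P id"
  let ?\<delta> = "hom_boundary 1 (subtopology X Q) (P \<inter> Q)"
  have D: "?D \<in> hom ?G ?H"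
    using group_homomorphism_hom_relboundary [of 2 X "P \<union> Q" P] by simp
  have "kernel ?H (relative_homology_group 1 X P) (hom_induced 1 (subtopology X (P \<union> Q)) P X P id)
      = ?D ` carrier ?G"
    using homology_exactness_triple_2 [of P "P \<union> Q" 2 X] by simp
  then have D_onto: "?D ` carrier ?G = carrier ?H"
    using triv hom_induced_carrier [of 1 "subtopology X (P \<union> Q)" P X P id]
    by (auto simp: kernel_def trivial_group_def)
  have XPQ: "openin (subtopology X (P \<union> Q)) P" "openin (subtopology X (P \<union> Q)) Q"
    using P Q by (auto simp: openin_subtopology)
  have "topspace (subtopology X (P \<union> Q)) - Q = P - Q"
    using openin_subset [OF P] openin_subset [OF Q] by auto
  then have "closedin (subtopology X (P \<union> Q)) (P - Q)"
    using closedin_diff [OF closedin_topspace XPQ(2)] by simp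
  \<comment> \<open>The set to excise is \<open>P - Q\<close>: it is closed in
    \<open>P \<union> Q\<close> because \<open>Q\<close> is open, and it lies in the open set
    \<open>P\<close>.\<close>
  then have "subtopology X (P \<union> Q) closure_of (P - Q) \<subseteq> subtopology X (P \<union> Q) interior_of P"
    using XPQ(1) by (simp add: closure_of_closedin interior_of_openin)
  moreover have "P \<union> Q - (P - Q) = Q" "P - (P - Q) = P \<inter> Q" "(P \<union> Q) \<inter> Q = Q"
    by auto
  ultimately have e: "?e \<in> iso ?K ?H"
    using homology_excision_axiom [of "subtopology X (P \<union> Q)" "P - Q" P "P \<union> Q" 1]
    by (simp add: subtopology_subtopology)
  have \<delta>: "?\<delta> \<in> hom ?K ?Z"
    using hom_boundary_hom [of 1 "subtopology X Q" "P \<inter> Q"]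
    by (simp add: subtopology_subtopology Int_ac)
  have QPQ: "Q \<inter> (P \<inter> Q) = P \<inter> Q"
    by auto
  have \<delta>_im: "kernel ?Z (homology_group 0 (subtopology X Q))
         (hom_induced 0 (subtopology X (P \<inter> Q)) {} (subtopology X Q) {} id) = ?\<delta> ` carrier ?K"
    using homology_exactness_axiom_2 [of 1 "subtopology X Q" "P \<inter> Q"]
    by (simp add: subtopology_subtopology QPQ)
  define e' where "e' = inv_into (carrier ?K) ?e"
  have e': "e' \<in> iso ?H ?K"
    unfolding e'_def by (rule group.iso_set_sym [OF _ e]) simp
  then have "e' ` carrier ?H = carrier ?K"
    by (simp add: iso_iff)
  show thesis
  proof
    show "(?\<delta> \<circ> e') \<circ> ?D \<in> hom ?G ?Z"
      using hom_compose [OF D hom_compose [OF iso_imp_homomorphism [OF e'] \<delta>]] .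
    show "(?\<delta> \<circ> e' \<circ> ?D) ` carrier ?G = kernel ?Z (homology_group 0 (subtopology X Q))
         (hom_induced 0 (subtopology X (P \<inter> Q)) {} (subtopology X Q) {} id)"
      by (simp only: image_comp [symmetric] D_onto \<open>e' ` carrier ?H = carrier ?K\<close> \<delta>_im)
  qed
qed

section \<open>Complements of graphs\<close>

lemma subtopology_Euclidean_space:
  "U \<subseteq> topspace (Euclidean_space n) \<Longrightarrow> subtopology (Euclidean_space n) U = top_of_set U"
  by (simp add: Euclidean_space_def euclidean_product_topology subtopology_subtopology Int_absorb1)

lemma Euclidean_space_eq_top_of_set:
  "Euclidean_space n = top_of_set (topspace (Euclidean_space n))"
  by (simp add: Euclidean_space_def euclidean_product_topology)

lemma continuous_on_fun_upd:
  fixes f :: "'a::topological_space \<Rightarrow> 'b \<Rightarrow> 'c::topological_space"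
  assumes "continuous_on A f" "continuous_on A h"
  shows "continuous_on A (\<lambda>z. (f z)(n := h z))"
proof (rule continuous_on_coordinatewise_then_product)
  show "continuous_on A (\<lambda>z. ((f z)(n := h z)) i)" for i
    using assms continuous_on_product_then_coordinatewise [OF assms(1)] by (cases "i = n") auto
qed

text \<open>The function is the distance to the complement of an open set of sequences whose trace
  is \<open>U\<close>. Its reciprocal blows up at the boundary of \<open>U\<close>.\<close>

lemma openin_Euclidean_space_positive_set:
  assumes "openin (Euclidean_space n) U"
  obtains g :: "(nat \<Rightarrow> real) \<Rightarrow> real" where "continuous_on UNIV g" "\<And>x. g x \<ge> 0"
    "U = {x \<in> topspace (Euclidean_space n). g x > 0}"
proof -
  have "openin (top_of_set (topspace (Euclidean_space n))) U"
    using assms Euclidean_space_eq_top_of_set by metis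
  then obtain V where V: "open V" "U = topspace (Euclidean_space n) \<inter> V"
    by (auto simp: openin_open)
  show thesis
  \<comment> \<open>\<open>infdist\<close> to the empty set is 0 by convention, so a full
    \<open>V\<close> needs a positive constant instead.\<close>
  proof (cases "V = UNIV")
    case True
    with V show thesis
      by (intro that [of "\<lambda>_. 1"]) auto
  next
    case False
    have "infdist x (- V) > 0 \<longleftrightarrow> x \<in> V" for x
      using in_closed_iff_infdist_zero [of "- V" x] V False infdist_nonneg [of x "- V"]
      by (auto simp: less_le)
    with V show thesis
      by (intro that [of "\<lambda>x. infdist x (- V)"]) (auto intro!: continuous_intros simp: infdist_nonneg)
  qed
qed

text \<open>Pushing upwards never leaves \<open>P\<close>, and a large enough push carries all of
  \<open>N\<close> into \<open>P\<close>. So the identity of the pair is homotopic, through maps of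
  pairs, to a map into \<open>P\<close>.\<close>

lemma trivial_relative_homology_above_graph:
  fixes g b :: "(nat \<Rightarrow> real) \<Rightarrow> real"
  assumes contg: "continuous_on UNIV g"
    and N: "N = {z. (\<forall>i\<ge>Suc n. z i = 0) \<and> g (z(n := 0)) > 0}"
    and P: "P = {z \<in> N. z(n := 0) \<in> S \<longrightarrow> z n * g (z(n := 0)) > 1}"
  shows "trivial_group (relative_homology_group p (top_of_set N) P)"
proof -
  \<comment> \<open>Pushes every point of \<open>N\<close> upwards, at time \<open>0\<close> past the graph of \<open>1 / g\<close>.\<close>
  define k where "k = (\<lambda>(s::real, z::nat \<Rightarrow> real). z(n := z n + (1 - s) * (\<bar>z n\<bar> + 2 / g (z(n := 0)))))"
  have k_N: "k (s, z) \<in> N" if "z \<in> N" "s \<in> {0..1}" for s z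
    using that by (auto simp: k_def N)
  have k_ge: "k (s, z) n \<ge> z n" if "z \<in> N" "s \<in> {0..1}" for s z
    using that by (auto simp: k_def N)
  have k_base: "(k (s, z))(n := 0) = z(n := 0)" for s z
    by (auto simp: k_def)
  have contk: "continuous_on ({0..1} \<times> N) k"
    unfolding k_def case_prod_unfold
    by (intro continuous_on_fun_upd continuous_on_add continuous_on_mult continuous_on_diff
          continuous_on_divide continuous_on_rabs continuous_on_const continuous_on_snd continuous_on_fst
          continuous_on_id continuous_on_compose2 [OF contg]
          continuous_on_compose2 [OF continuous_on_product_coordinates]) (auto simp: N)
  have k0: "k (0, z) \<in> P" if z: "z \<in> N" for z
  proof -
    have g: "g (z(n := 0)) > 0"
      using z by (simp add: N)
    have "k (0, z) n * g (z(n := 0)) = (z n + \<bar>z n\<bar>) * g (z(n := 0)) + 2"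
      using g by (simp add: k_def field_simps)
    moreover have "(z n + \<bar>z n\<bar>) * g (z(n := 0)) \<ge> 0"
      using g by simp
    ultimately show ?thesis
      using k_N [OF z, of 0] by (simp add: P k_base)
  qed
  show ?thesis
  proof (rule trivial_relative_homology_group_alt)
    show "continuous_map (top_of_set N) (subtopology (top_of_set N) P) (\<lambda>z. k (0, z))"
    proof -
      have "continuous_on N (\<lambda>z. k (0, z))"
        by (rule continuous_on_compose2 [OF contk]) (auto intro!: continuous_intros)
      then show ?thesis
        using k0 k_N by (auto simp: continuous_map_in_subtopology)
    qed
    show "homotopic_with (\<lambda>k. k ` P \<subseteq> P) (top_of_set N) (top_of_set N) (\<lambda>z. k (0, z)) id"
      unfolding homotopic_with_def
    proof (intro exI [where x = k] conjI ballI allI)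
      have "prod_topology (top_of_set {0..1::real}) (top_of_set N) = top_of_set ({0..1} \<times> N)"
        by (simp flip: subtopology_Times)
      then show "continuous_map (prod_topology (top_of_set {0..1}) (top_of_set N)) (top_of_set N) k"
        using contk k_N by auto
      show "k (1, z) = id z" for z
        by (simp add: k_def)
      fix t :: real
      assume t: "t \<in> {0..1}"
      have "k (t, z) \<in> P" if z: "z \<in> P" for z
      proof -
        have zN: "z \<in> N" and "g (z(n := 0)) > 0"
          using z by (auto simp: P N)
        then have "z n * g (z(n := 0)) \<le> k (t, z) n * g (z(n := 0))"
          using k_ge [OF zN t] by simp
        then show ?thesis
          using z k_N [OF zN t] by (auto simp: P k_base)
      qed
      then show "(\<lambda>x. k (t, x)) ` P \<subseteq> P"
        by blast
    qed auto
  qed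
qed

text \<open>Every point of \<open>Q\<close> moves vertically to height 0 without crossing the graph,
  since shrinking the height towards 0 keeps its product with \<open>g\<close> below 1. The slice of
  \<open>Q\<close> at height 0 is the path-connected set \<open>U\<close>.\<close>

lemma path_connected_below_graph:
  fixes g :: "(nat \<Rightarrow> real) \<Rightarrow> real"
  assumes U: "path_connected U" "U = {z. (\<forall>i\<ge>n. z i = 0) \<and> g z > 0}"
    and Q: "Q = {z. (\<forall>i\<ge>Suc n. z i = 0) \<and> g (z(n := 0)) > 0 \<and> (z(n := 0) \<in> S \<longrightarrow> z n * g (z(n := 0)) < 1)}"
  shows "path_connected Q"
proof -
  have UQ: "U \<subseteq> Q"
  proof
    fix z
    assume z: "z \<in> U"
    then have "z(n := 0) = z"
      using U(2) by auto
    then show "z \<in> Q"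
      using z by (auto simp: U(2) Q)
  qed
  have base: "z(n := 0) \<in> U" if "z \<in> Q" for z
    using that by (auto simp: U(2) Q Suc_le_eq)
  have down: "path_component Q z (z(n := 0))" if z: "z \<in> Q" for z
    unfolding path_component_def
  proof (intro exI conjI)
    let ?p = "\<lambda>t::real. z(n := (1 - t) * z n)"
    show "path ?p"
      unfolding path_def
      by (intro continuous_on_fun_upd continuous_on_const continuous_on_mult continuous_on_diff continuous_on_id)
    show "path_image ?p \<subseteq> Q"
    proof (clarsimp simp: path_image_def)
      fix t :: real
      assume t: "0 \<le> t" "t \<le> 1"
      have g: "g (z(n := 0)) > 0"
        using z by (simp add: Q)
      have "(1 - t) * (z n * g (z(n := 0))) < 1" if "z n * g (z(n := 0)) < 1"
      proof (cases "z n * g (z(n := 0)) \<le> 0")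
        case True
        then have "(1 - t) * (z n * g (z(n := 0))) \<le> 0"
          using t by (simp add: mult_nonneg_nonpos)
        then show ?thesis by simp
      next
        case False
        then have "(1 - t) * (z n * g (z(n := 0))) \<le> z n * g (z(n := 0))"
          using t by (intro mult_left_le_one_le) auto
        then show ?thesis
          using that by simp
      qed
      then show "?p t \<in> Q"
        using z by (auto simp: Q mult.assoc)
    qed
  qed (auto simp: pathstart_def pathfinish_def)
  show ?thesis
    unfolding path_connected_component
  proof (intro ballI)
    fix y z
    assume yz: "y \<in> Q" "z \<in> Q"
    have "path_component U (y(n := 0)) (z(n := 0))"
      using U(1) base yz by (simp add: path_connected_component)
    then have "path_component Q (y(n := 0)) (z(n := 0))"
      using UQ path_component_of_subset by blast
    then show "path_component Q y z"
      using down yz path_component_trans path_component_sym by meson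
  qed
qed

text \<open>Points of \<open>U - S\<close>, placed at height 0, have equal classes in the
  path-connected set \<open>Q\<close>, so their difference in \<open>P \<inter> Q\<close> lies in
  the kernel that is reached from degree 2. Forgetting the height carries it to
  \<open>U - S\<close>. Coordinate \<open>n\<close>, which vanishes on
  \<open>Euclidean_space n\<close>, serves as the height.\<close>

lemma point_differences_from_graph_complement:
  assumes U: "openin (Euclidean_space n) U" and pcU: "path_connectedin (Euclidean_space n) U"
    and S: "closedin (subtopology (Euclidean_space n) U) S"
  shows "\<exists>\<Gamma> \<psi>. closedin (Euclidean_space (Suc n)) \<Gamma> \<and>
    subtopology (Euclidean_space (Suc n)) \<Gamma> homeomorphic_space subtopology (Euclidean_space n) S \<and>
    \<psi> \<in> hom (relative_homology_group 2 (Euclidean_space (Suc n)) (topspace (Euclidean_space (Suc n)) - \<Gamma>))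
             (homology_group 0 (subtopology (Euclidean_space n) (U - S))) \<and>
    (\<forall>a \<in> U - S. \<forall>b \<in> U - S. point_difference (subtopology (Euclidean_space n) (U - S)) a b
        \<in> \<psi> ` carrier (relative_homology_group 2 (Euclidean_space (Suc n))
                 (topspace (Euclidean_space (Suc n)) - \<Gamma>)))"
proof -
  let ?E = "Euclidean_space (Suc n)"
  have topE: "topspace ?E = {z. \<forall>i\<ge>Suc n. z i = 0}"
    by (simp add: topspace_Euclidean_space)
  obtain g :: "(nat \<Rightarrow> real) \<Rightarrow> real" where contg: "continuous_on UNIV g" and g0: "\<And>x. g x \<ge> 0"
    and U_eq: "U = {x. (\<forall>i\<ge>n. x i = 0) \<and> g x > 0}"
    using openin_Euclidean_space_positive_set [OF U] by (auto simp: topspace_Euclidean_space)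
  \<comment> \<open>\<open>S\<close> is closed only relative to \<open>U\<close>; \<open>T\<close>
    is closed in the whole space and agrees with \<open>S\<close> on \<open>U\<close>.\<close>
  obtain T where "closedin (Euclidean_space n) T" and S_eq: "S = T \<inter> U"
    using S by (auto simp: closedin_subtopology)
  then have T: "closed T"
    using closedin_Euclidean_imp_closed by blast
  have base: "z(n := 0) \<in> U \<longleftrightarrow> g (z(n := 0)) > 0" if "\<forall>i\<ge>Suc n. z i = 0" for z
    using that by (auto simp: U_eq Suc_le_eq)
  have U_upd [simp]: "x(n := 0) = x" if "x \<in> U" for x
    using that by (auto simp: U_eq)
  have Usub: "U \<subseteq> topspace (Euclidean_space n)" "U \<subseteq> topspace ?E"
    by (auto simp: U_eq topspace_Euclidean_space)
  have cont_base: "continuous_on A (\<lambda>z::nat\<Rightarrow>real. z(n := 0))" for A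
    by (intro continuous_on_fun_upd continuous_on_const continuous_on_id)
  have cont_gb: "continuous_on A (\<lambda>z::nat\<Rightarrow>real. g (z(n := 0)))" for A
    by (rule continuous_on_compose2 [OF contg cont_base]) auto
  have cont_height: "continuous_on A (\<lambda>z::nat\<Rightarrow>real. z n * g (z(n := 0)))" for A
    by (intro continuous_on_mult cont_gb continuous_on_compose2 [OF continuous_on_product_coordinates continuous_on_id]) auto
  \<comment> \<open>Over \<open>U\<close> this is the graph of \<open>1 / g\<close> on
    \<open>S\<close>. Written as a product, the equation forces \<open>g\<close> to be nonzero, so
    nothing lies outside \<open>N\<close>; and as it is cut out by continuous conditions,
    \<open>\<Gamma>\<close> is closed in the whole space although \<open>S\<close> may not
    be.\<close>
  define \<Gamma> where "\<Gamma> = {z \<in> topspace ?E. z(n := 0) \<in> T \<and> z n * g (z(n := 0)) = 1}"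
  \<comment> \<open>\<open>N\<close> is \<open>U\<close> times a line. \<open>P\<close> and
    \<open>Q\<close> are above and below the graph over \<open>S\<close>, and both contain
    everything over \<open>U - S\<close>; hence their union is \<open>N - \<Gamma>\<close> and their
    intersection is \<open>U - S\<close> times a line.\<close>
  define N where "N = {z. (\<forall>i\<ge>Suc n. z i = 0) \<and> g (z(n := 0)) > 0}"
  define P where "P = {z \<in> N. z(n := 0) \<in> T \<longrightarrow> z n * g (z(n := 0)) > 1}"
  define Q where "Q = {z \<in> N. z(n := 0) \<in> T \<longrightarrow> z n * g (z(n := 0)) < 1}"
  have ETop: "?E = top_of_set (topspace ?E)"
    by (rule Euclidean_space_eq_top_of_set)
  have NE: "N \<subseteq> topspace ?E"
    by (auto simp: N_def topE)
  have subE: "subtopology ?E N = top_of_set N"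
    by (simp add: NE subtopology_Euclidean_space)
  have "openin ?E N"
  proof -
    have "openin (top_of_set (topspace ?E)) (topspace ?E \<inter> (\<lambda>z. g (z(n := 0))) -` {0<..})"
      by (intro continuous_openin_preimage_gen cont_gb) auto
    moreover have "topspace ?E \<inter> (\<lambda>z. g (z(n := 0))) -` {0<..} = N"
      by (auto simp: N_def topE)
    ultimately show ?thesis
      using ETop by simp
  qed
  have clo\<Gamma>: "closedin ?E \<Gamma>"
  proof -
    have 1: "closed ((\<lambda>z::nat\<Rightarrow>real. z(n := 0)) -` T)"
      using T cont_base by (rule closed_vimage)
    have 2: "closed ((\<lambda>z::nat\<Rightarrow>real. z n * g (z(n := 0))) -` {1})"
      using cont_height by (intro closed_vimage) auto
    have "\<Gamma> = topspace ?E \<inter> ((\<lambda>z. z(n := 0)) -` T \<inter> (\<lambda>z. z n * g (z(n := 0))) -` {1})"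
      by (auto simp: \<Gamma>_def)
    moreover have "closed (topspace ?E)"
      using closedin_Euclidean_imp_closed closedin_topspace by blast
    ultimately show ?thesis
      using 1 2 by (auto simp: closedin_Euclidean_space_iff)
  qed
  have PQ: "openin (top_of_set N) P" "openin (top_of_set N) Q"
  proof -
    have 1: "openin (top_of_set N) (N \<inter> (\<lambda>z. z(n := 0)) -` (- T))"
      using T by (intro continuous_openin_preimage_gen cont_base) auto
    have "openin (top_of_set N) (N \<inter> (\<lambda>z. z n * g (z(n := 0))) -` {1<..})"
      by (intro continuous_openin_preimage_gen cont_height) auto
    then have "openin (top_of_set N) (N \<inter> (\<lambda>z. z(n := 0)) -` (- T) \<union> N \<inter> (\<lambda>z. z n * g (z(n := 0))) -` {1<..})"
      using 1 by blast
    moreover have "N \<inter> (\<lambda>z. z(n := 0)) -` (- T) \<union> N \<inter> (\<lambda>z. z n * g (z(n := 0))) -` {1<..} = P"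
      by (auto simp: P_def)
    ultimately show "openin (top_of_set N) P"
      by simp
    have "openin (top_of_set N) (N \<inter> (\<lambda>z. z n * g (z(n := 0))) -` {..<1})"
      by (intro continuous_openin_preimage_gen cont_height) auto
    then have "openin (top_of_set N) (N \<inter> (\<lambda>z. z(n := 0)) -` (- T) \<union> N \<inter> (\<lambda>z. z n * g (z(n := 0))) -` {..<1})"
      using 1 by blast
    moreover have "N \<inter> (\<lambda>z. z(n := 0)) -` (- T) \<union> N \<inter> (\<lambda>z. z n * g (z(n := 0))) -` {..<1} = Q"
      by (auto simp: Q_def)
    ultimately show "openin (top_of_set N) Q"
      by simp
  qed
  have PuQ: "P \<union> Q = N - \<Gamma>"
    using NE by (auto simp: P_def Q_def \<Gamma>_def)
  have PiQ: "P \<inter> Q = {z \<in> N. z(n := 0) \<notin> T}"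
    by (auto simp: P_def Q_def)
  have homeo: "subtopology ?E \<Gamma> homeomorphic_space subtopology (Euclidean_space n) S"
  proof -
    have sub: "subtopology ?E \<Gamma> = top_of_set \<Gamma>" "subtopology (Euclidean_space n) S = top_of_set S"
      using Usub by (auto intro!: subtopology_Euclidean_space simp: \<Gamma>_def S_eq)
    have gpos: "g (z(n := 0)) > 0" if "z \<in> \<Gamma>" for z
      using that g0 [of "z(n := 0)"] by (auto simp: \<Gamma>_def less_le)
    have 1: "z(n := 0) \<in> S" "z(n := 1 / g (z(n := 0))) = z" if "z \<in> \<Gamma>" for z
      using that gpos [OF that] base [of z] by (auto simp: \<Gamma>_def S_eq topE fun_eq_iff field_simps)
    have 2: "x(n := 1 / g x) \<in> \<Gamma>" if "x \<in> S" for x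
      using that by (auto simp: \<Gamma>_def S_eq U_eq topE)
    have "homeomorphic_maps (top_of_set \<Gamma>) (top_of_set S) (\<lambda>z. z(n := 0)) (\<lambda>x. x(n := 1 / g x))"
      unfolding homeomorphic_maps_def
    proof (intro conjI)
      show "continuous_map (top_of_set \<Gamma>) (top_of_set S) (\<lambda>z. z(n := 0))"
        using 1 cont_base by auto
      have "continuous_on S (\<lambda>x. x(n := 1 / g x))"
        by (intro continuous_on_fun_upd continuous_on_divide continuous_on_const continuous_on_id
             continuous_on_subset [OF contg]) (auto simp: S_eq U_eq)
      then show "continuous_map (top_of_set S) (top_of_set \<Gamma>) (\<lambda>x. x(n := 1 / g x))"
        using 2 by auto
    qed (use 1 S_eq in auto)
    then show ?thesis
      unfolding sub homeomorphic_space_def by blast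
  qed
  let ?G = "relative_homology_group 2 ?E (topspace ?E - \<Gamma>)"
  let ?G' = "relative_homology_group 2 (top_of_set N) (P \<union> Q)"
  \<comment> \<open>The complement of \<open>N\<close> is closed and contained in the open
    complement of \<open>\<Gamma>\<close>, so it can be excised.\<close>
  have excision: "hom_induced 2 (top_of_set N) (P \<union> Q) ?E (topspace ?E - \<Gamma>) id \<in> iso ?G' ?G"
  proof -
    have "closedin ?E (topspace ?E - N)"
      using \<open>openin ?E N\<close> by blast
    moreover have "openin ?E (topspace ?E - \<Gamma>)"
      using clo\<Gamma> by blast
    moreover have "\<Gamma> \<subseteq> N"
      using g0 by (force simp: \<Gamma>_def N_def topE less_le)
    ultimately have "?E closure_of (topspace ?E - N) \<subseteq> ?E interior_of (topspace ?E - \<Gamma>)"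
      by (auto simp: closure_of_closedin interior_of_openin)
    moreover have "topspace ?E - (topspace ?E - N) = N" "topspace ?E - \<Gamma> - (topspace ?E - N) = P \<union> Q"
      using NE PuQ by auto
    ultimately show ?thesis
      using homology_excision_axiom [of ?E "topspace ?E - N" "topspace ?E - \<Gamma>" "topspace ?E" 2]
      by (simp add: subE)
  qed
  let ?Z = "top_of_set (P \<inter> Q)"
  let ?W = "subtopology (Euclidean_space n) (U - S)"
  have subZ: "subtopology (top_of_set N) (P \<inter> Q) = ?Z" "subtopology (top_of_set N) Q = top_of_set Q"
    by (auto simp: subtopology_subtopology P_def Q_def intro!: arg_cong [of _ _ top_of_set])
  have Weq: "?W = top_of_set (U - S)"
    using Usub by (intro subtopology_Euclidean_space) auto
  have "trivial_group (relative_homology_group 1 (top_of_set N) P)"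
    by (rule trivial_relative_homology_above_graph [OF contg N_def P_def])
  then obtain \<phi> where \<phi>: "\<phi> \<in> hom ?G' (homology_group 0 ?Z)"
    and \<phi>_im: "\<phi> ` carrier ?G' = kernel (homology_group 0 ?Z) (homology_group 0 (top_of_set Q))
         (hom_induced 0 ?Z {} (top_of_set Q) {} id)"
    using zeroth_homology_kernel_epimorphic_image [OF PQ] unfolding subZ by blast
  let ?i = "hom_induced 0 ?Z {} (top_of_set Q) {} id"
  let ?r = "hom_induced 0 ?Z {} ?W {} (\<lambda>z. z(n := 0))"
  have r: "?r \<in> hom (homology_group 0 ?Z) (homology_group 0 ?W)"
    by (rule hom_induced_hom)
  have cmr: "continuous_map ?Z ?W (\<lambda>z. z(n := 0))"
    unfolding Weq using cont_base base by (auto simp: PiQ S_eq N_def)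
  define \<epsilon> where "\<epsilon> = inv_into (carrier ?G') (hom_induced 2 (top_of_set N) (P \<union> Q) ?E (topspace ?E - \<Gamma>) id)"
  have \<epsilon>: "\<epsilon> \<in> iso ?G ?G'"
    unfolding \<epsilon>_def by (rule group.iso_set_sym [OF _ excision]) simp
  show ?thesis
  proof (intro exI conjI ballI)
    show "closedin ?E \<Gamma>" "subtopology ?E \<Gamma> homeomorphic_space subtopology (Euclidean_space n) S"
      by (rule clo\<Gamma> homeo)+
    show "(?r \<circ> \<phi>) \<circ> \<epsilon> \<in> hom ?G (homology_group 0 ?W)"
      using hom_compose [OF iso_imp_homomorphism [OF \<epsilon>] hom_compose [OF \<phi> r]] .
    fix a b
    assume ab: "a \<in> U - S" "b \<in> U - S"
    have inZ: "x \<in> topspace ?Z" "x \<in> topspace (top_of_set Q)" "x(n := 0) = x" if "x \<in> U - S" for x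
    proof -
      have "x(n := 0) = x" "\<forall>i\<ge>Suc n. x i = 0" "g x > 0" "x \<notin> T"
        using that by (auto simp: S_eq U_eq)
      then show "x \<in> topspace ?Z" "x \<in> topspace (top_of_set Q)" "x(n := 0) = x"
        by (auto simp: P_def Q_def N_def)
    qed
    interpret r: group_hom "homology_group 0 ?Z" "homology_group 0 ?W" ?r
      by (simp add: group_hom_def group_hom_axioms_def r)
    interpret i: group_hom "homology_group 0 ?Z" "homology_group 0 (top_of_set Q)" ?i
      by (simp add: group_hom_def group_hom_axioms_def hom_induced_hom)
    let ?d = "point_class ?Z a \<otimes>\<^bsub>homology_group 0 ?Z\<^esub> inv\<^bsub>homology_group 0 ?Z\<^esub> point_class ?Z b"
    have pcs: "point_class ?Z a \<in> carrier (homology_group 0 ?Z)" "point_class ?Z b \<in> carrier (homology_group 0 ?Z)"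
      by (rule point_class_in_carrier, use inZ ab in blast)+
    have "path_connected U"
      using pcU subtopology_Euclidean_space [OF Usub(1)] path_connectedin_euclidean [of U]
      by (simp add: path_connectedin_def)
    then have "path_connected Q"
      by (rule path_connected_below_graph [where S = T, OF _ U_eq]) (auto simp: Q_def N_def)
    then have "path_connected_space (top_of_set Q)"
      using path_connectedin_euclidean [of Q] by (simp add: path_connectedin_def)
    then have "point_class (top_of_set Q) a = point_class (top_of_set Q) b"
      using inZ ab by (intro point_class_eq) blast+
    moreover have "?i (point_class ?Z x) = point_class (top_of_set Q) x" if "x \<in> U - S" for x
      using hom_induced_point_class [of ?Z "top_of_set Q" id x] inZ [OF that] by simp
    ultimately have "?i ?d = \<one>\<^bsub>homology_group 0 (top_of_set Q)\<^esub>"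
      using pcs ab by (simp add: point_class_in_carrier [OF inZ(2)])
    then have "?d \<in> \<phi> ` carrier ?G'"
      unfolding \<phi>_im kernel_def using pcs by simp
    then obtain y where y: "y \<in> carrier ?G'" "?d = \<phi> y"
      by blast
    moreover have "\<epsilon> ` carrier ?G = carrier ?G'"
      using \<epsilon> by (simp add: iso_iff)
    ultimately obtain x where "x \<in> carrier ?G" "y = \<epsilon> x"
      by blast
    with y have "?r ?d \<in> ((?r \<circ> \<phi>) \<circ> \<epsilon>) ` carrier ?G"
      by (intro image_eqI [of _ _ x]) simp_all
    moreover have "?r (point_class ?Z x) = point_class ?W x" if "x \<in> U - S" for x
      using hom_induced_point_class [OF cmr inZ(1) [OF that]] inZ(3) [OF that] by simp
    ultimately show "point_difference ?W a b \<in> ((?r \<circ> \<phi>) \<circ> \<epsilon>) ` carrier ?G"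
      using pcs ab by (simp add: point_difference_def)
  qed
qed

section \<open>Codimension one subsets of Euclidean open sets\<close>

lemma zeroth_homology_powers:
  assumes "path_connected_space X" "a \<in> topspace X" "c \<in> carrier (homology_group 0 X)"
  obtains k :: int where "c = point_class X a [^]\<^bsub>homology_group 0 X\<^esub> k"
proof -
  have "pow (homology_group 0 X) (point_class X a) \<in> iso integer_group (homology_group 0 X)"
    unfolding point_class_def
    by (rule iso_integer_zeroth_homology_group [OF assms(1) singular_simplex_point [OF assms(2)]])
  then have "range (pow (homology_group 0 X) (point_class X a) :: int \<Rightarrow> _) = carrier (homology_group 0 X)"
    by (simp add: iso_iff)
  then show thesis
    using that assms(3) by blast
qed

text \<open>Exactness of the sequence of the pair, as homology in degree -1 is trivial.\<close>

lemma relative_zeroth_homology_epimorphism: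
  "hom_induced 0 X {} X S id ` carrier (homology_group 0 X) = carrier (relative_homology_group 0 X S)"
proof -
  have "kernel (relative_homology_group 0 X S) (homology_group (-1) (subtopology X S)) (hom_boundary 0 X S)
     = hom_induced 0 X {} X S id ` carrier (homology_group 0 X)"
    using homology_exactness_axiom_1 [of 0 X S] by simp
  moreover have "hom_boundary 0 X S c = \<one>\<^bsub>homology_group (-1) (subtopology X S)\<^esub>" for c
    using trivial_homology_group [of "-1" "subtopology X S"] hom_boundary_carrier [of 0 X S c]
    by (simp add: trivial_group_def)
  ultimately show ?thesis
    by (auto simp: kernel_def)
qed

text \<open>The group is a quotient of the infinite cyclic group
  \<open>homology_group 0 X\<close>.\<close>

lemma cyclic_relative_zeroth_homology:
  assumes "path_connected_space X" "a \<in> topspace X"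
  shows "cyclic_group (relative_homology_group 0 X S)"
proof -
  have "homology_group 0 X \<cong> integer_group"
    using assms by (intro isomorphic_integer_zeroth_homology_group) auto
  then have "cyclic_group (homology_group 0 X)"
    using isomorphic_group_cyclicity by force
  moreover have "hom_induced 0 X {} X S id \<in> epi (homology_group 0 X) (relative_homology_group 0 X S)"
    by (simp add: epi_def hom_induced_hom relative_zeroth_homology_epimorphism)
  ultimately show ?thesis
    using group.cyclic_group_epimorphic_image group_relative_homology_group by blast
qed

text \<open>The class of the point \<open>a\<close> of \<open>S\<close> generates
  \<open>homology_group 0 X\<close>. It comes from the homology of \<open>S\<close>, hence dies in
  the relative group, onto which \<open>homology_group 0 X\<close> maps.\<close>

lemma trivial_relative_zeroth_homology:
  assumes "path_connected_space X" and a: "a \<in> topspace X" "a \<in> S"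
  shows "trivial_group (relative_homology_group 0 X S)"
proof -
  let ?i = "hom_induced 0 X {} X S id"
  interpret i: group_hom "homology_group 0 X" "relative_homology_group 0 X S" ?i
    by (simp add: group_hom_def group_hom_axioms_def hom_induced_hom)
  have "point_class X a = hom_induced 0 (subtopology X S) {} X {} id (point_class (subtopology X S) a)"
    using hom_induced_point_class [of "subtopology X S" X id a] a by simp
  moreover have "kernel (homology_group 0 X) (relative_homology_group 0 X S) ?i
     = hom_induced 0 (subtopology X S) {} X {} id ` carrier (homology_group 0 (subtopology X S))"
    using homology_exactness_axiom_3 [of 0 X S] by simp
  ultimately have "point_class X a \<in> kernel (homology_group 0 X) (relative_homology_group 0 X S) ?i"
    using point_class_in_carrier [of a "subtopology X S"] a by auto
  then have one: "?i (point_class X a) = \<one>\<^bsub>relative_homology_group 0 X S\<^esub>"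
    by (simp add: kernel_def)
  have "?i c = \<one>\<^bsub>relative_homology_group 0 X S\<^esub>" if c: "c \<in> carrier (homology_group 0 X)" for c
  proof -
    obtain k :: int where "c = point_class X a [^]\<^bsub>homology_group 0 X\<^esub> k"
      using zeroth_homology_powers [OF assms(1) a(1) c] .
    then show ?thesis
      by (simp add: i.hom_int_pow point_class_in_carrier a one)
  qed
  then show ?thesis
    unfolding i.H.trivial_group_subset relative_zeroth_homology_epimorphism [of X S, symmetric]
    by blast
qed

section \<open>Duality for complements of closed sets in Euclidean spaces\<close>

lemma closedin_Euclidean_space_mono:
  "\<lbrakk>closedin (Euclidean_space m) S; m \<le> n\<rbrakk> \<Longrightarrow> closedin (Euclidean_space n) S"
  using subset_Euclidean_space [THEN iffD2, of m n] unfolding closedin_Euclidean_space_iff by blast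

lemma subtopology_Euclidean_space_mono:
  assumes "S \<subseteq> topspace (Euclidean_space m)" "m \<le> n"
  shows "subtopology (Euclidean_space n) S = subtopology (Euclidean_space m) S"
proof -
  have "S \<subseteq> topspace (Euclidean_space n)"
    using assms subset_Euclidean_space [THEN iffD2, of m n] by blast
  with assms(1) show ?thesis
    by (simp add: subtopology_Euclidean_space)
qed

text \<open>Homeomorphic closed subsets of one Euclidean space have isomorphic relative groups of
  their complements, so \<open>\<Gamma>\<close> may be replaced by \<open>S'\<close> inside
  \<open>\<real>^(m+2)\<close>. Lowering the dimension of the ambient space by two then lowers the
  degree by two.\<close>

lemma relative_homology_complement_codim_2:
  assumes \<Gamma>: "closedin (Euclidean_space (m + 2)) \<Gamma>" and S': "closedin (Euclidean_space m) S'"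
    and hom: "subtopology (Euclidean_space (m + 2)) \<Gamma> homeomorphic_space subtopology (Euclidean_space m) S'"
  shows "relative_homology_group 2 (Euclidean_space (m + 2)) (topspace (Euclidean_space (m + 2)) - \<Gamma>)
    \<cong> relative_homology_group 0 (Euclidean_space m) (topspace (Euclidean_space m) - S')"
proof -
  have "subtopology (Euclidean_space (m + 2)) S' = subtopology (Euclidean_space m) S'"
    using closedin_subset [OF S'] by (intro subtopology_Euclidean_space_mono) auto
  then have 1: "relative_homology_group 2 (Euclidean_space (m + 2)) (topspace (Euclidean_space (m + 2)) - \<Gamma>)
    \<cong> relative_homology_group 2 (Euclidean_space (m + 2)) (topspace (Euclidean_space (m + 2)) - S')"
    using hom closedin_Euclidean_space_mono [OF S', of "m + 2"]
    by (intro isomorphic_relative_homology_groups_Euclidean_complements \<Gamma>) auto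
  have "relative_homology_group 0 (Euclidean_space m) (topspace (Euclidean_space m) - S')
    \<cong> relative_homology_group 2 (Euclidean_space (m + 2)) (topspace (Euclidean_space (m + 2)) - S')"
    using relative_homology_group_Euclidean_complement_step [OF S', of 0 2] by simp
  then have "relative_homology_group 2 (Euclidean_space (m + 2)) (topspace (Euclidean_space (m + 2)) - S')
    \<cong> relative_homology_group 0 (Euclidean_space m) (topspace (Euclidean_space m) - S')"
    by (rule group.iso_sym [rotated]) simp
  with 1 show ?thesis
    by (rule iso_trans)
qed

text \<open>The point of this form is that the source \<open>G\<close> depends on the model
  \<open>S'\<close> alone, while \<open>U\<close> and the embedding of \<open>S\<close> enter only
  through \<open>W\<close>.\<close>

lemma codim_1_complement_point_classes:
  assumes U: "openin (Euclidean_space (Suc m)) U" and pcU: "path_connectedin (Euclidean_space (Suc m)) U"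
    and S: "closedin (subtopology (Euclidean_space (Suc m)) U) S"
    and S': "closedin (Euclidean_space m) S'"
    and hom: "subtopology (Euclidean_space (Suc m)) S homeomorphic_space subtopology (Euclidean_space m) S'"
  defines "W \<equiv> subtopology (Euclidean_space (Suc m)) (U - S)"
    and "G \<equiv> relative_homology_group 0 (Euclidean_space m) (topspace (Euclidean_space m) - S')"
  shows "\<exists>\<psi> \<in> hom G (homology_group 0 W). \<forall>a \<in> U - S. \<forall>b \<in> U - S. point_difference W a b \<in> \<psi> ` carrier G"
proof -
  let ?H = "\<lambda>\<Gamma>. relative_homology_group 2 (Euclidean_space (Suc (Suc m))) (topspace (Euclidean_space (Suc (Suc m))) - \<Gamma>)"
  have "\<exists>\<Gamma> \<psi>. closedin (Euclidean_space (Suc (Suc m))) \<Gamma> \<and>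
    subtopology (Euclidean_space (Suc (Suc m))) \<Gamma> homeomorphic_space subtopology (Euclidean_space (Suc m)) S \<and>
    \<psi> \<in> hom (?H \<Gamma>) (homology_group 0 W) \<and>
    (\<forall>a \<in> U - S. \<forall>b \<in> U - S. point_difference W a b \<in> \<psi> ` carrier (?H \<Gamma>))"
    unfolding W_def by (rule point_differences_from_graph_complement [OF U pcU S])
  then obtain \<Gamma> \<psi> where \<Gamma>: "closedin (Euclidean_space (Suc (Suc m))) \<Gamma>"
    and \<Gamma>S: "subtopology (Euclidean_space (Suc (Suc m))) \<Gamma> homeomorphic_space subtopology (Euclidean_space (Suc m)) S"
    and \<psi>: "\<psi> \<in> hom (?H \<Gamma>) (homology_group 0 W)"
    and diff: "\<forall>a \<in> U - S. \<forall>b \<in> U - S. point_difference W a b \<in> \<psi> ` carrier (?H \<Gamma>)"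
    by (elim exE conjE) (rule that)
  have "?H \<Gamma> \<cong> G"
    using relative_homology_complement_codim_2 [of m \<Gamma> S'] \<Gamma> S' homeomorphic_space_trans [OF \<Gamma>S hom]
    by (simp add: G_def)
  then have "G \<cong> ?H \<Gamma>"
    by (rule group.iso_sym [rotated]) simp
  then obtain f where f: "f \<in> iso G (?H \<Gamma>)"
    by (auto simp: is_iso_def)
  then have "f ` carrier G = carrier (?H \<Gamma>)"
    by (simp add: iso_iff)
  have "\<psi> \<circ> f \<in> hom G (homology_group 0 W)"
    by (rule hom_compose [OF iso_imp_homomorphism [OF f] \<psi>])
  moreover have "(\<psi> \<circ> f) ` carrier G = \<psi> ` carrier (?H \<Gamma>)"
    by (simp only: image_comp [symmetric] \<open>f ` carrier G = carrier (?H \<Gamma>)\<close>)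
  ultimately show ?thesis
    using diff by (intro bexI [of _ "\<psi> \<circ> f"]) simp_all
qed

text \<open>As \<open>S'\<close> misses a point, \<open>G\<close> is trivial and every point
  difference vanishes. A nontrivial clopen subset would have an indicator homomorphism with value 1
  on some point difference.\<close>

lemma connectedin_complement_proper_codim_1:
  assumes U: "openin (Euclidean_space (Suc m)) U" and pcU: "path_connectedin (Euclidean_space (Suc m)) U"
    and S: "closedin (subtopology (Euclidean_space (Suc m)) U) S"
    and S': "closedin (Euclidean_space m) S'" "S' \<noteq> topspace (Euclidean_space m)"
    and hom: "subtopology (Euclidean_space (Suc m)) S homeomorphic_space subtopology (Euclidean_space m) S'"
  shows "connectedin (Euclidean_space (Suc m)) (U - S)"
proof -
  define W where "W = subtopology (Euclidean_space (Suc m)) (U - S)"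
  define G where "G = relative_homology_group 0 (Euclidean_space m) (topspace (Euclidean_space m) - S')"
  have topW: "topspace W = U - S"
    using openin_subset [OF U] by (auto simp: W_def)
  have "\<exists>\<psi> \<in> hom G (homology_group 0 W). \<forall>a \<in> U - S. \<forall>b \<in> U - S. point_difference W a b \<in> \<psi> ` carrier G"
    unfolding W_def G_def by (rule codim_1_complement_point_classes [OF U pcU S S'(1) hom])
  then obtain \<psi> where \<psi>: "\<psi> \<in> hom G (homology_group 0 W)"
    and diff: "\<And>a b. \<lbrakk>a \<in> U - S; b \<in> U - S\<rbrakk> \<Longrightarrow> point_difference W a b \<in> \<psi> ` carrier G"
    by blast
  interpret \<psi>: group_hom G "homology_group 0 W" \<psi>
    by (simp add: group_hom_def group_hom_axioms_def \<psi>) (simp add: G_def)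
  obtain p where "p \<in> topspace (Euclidean_space m)" "p \<in> topspace (Euclidean_space m) - S'"
    using S' closedin_subset by blast
  then have "trivial_group G"
    unfolding G_def using path_connected_Euclidean_space trivial_relative_zeroth_homology by metis
  then have im: "\<psi> ` carrier G = {\<one>\<^bsub>homology_group 0 W\<^esub>}"
    by (simp add: trivial_group_def)
  have "A = {} \<or> A = topspace W" if A: "closedin W A" "openin W A" for A
  proof (rule ccontr)
    assume "\<not> ?thesis"
    then obtain a b where ab: "a \<in> A" "b \<in> U - S" "b \<notin> A"
      using topW closedin_subset [OF A(1)] by blast
    then have a: "a \<in> U - S"
      using topW closedin_subset [OF A(1)] by blast
    obtain h where h: "h \<in> hom (homology_group 0 W) integer_group"
      "\<And>a. a \<in> topspace W \<Longrightarrow> h (point_class W a) = (if a \<in> A then 1 else 0)"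
      using zeroth_homology_clopen_indicator [OF A(2,1)] by blast
    interpret h: group_hom "homology_group 0 W" integer_group h
      by (simp add: group_hom_def group_hom_axioms_def h(1))
    have "point_difference W a b
        = \<one>\<^bsub>homology_group 0 W\<^esub>"
      using diff [OF a ab(2)] im by simp
    then have "h (point_difference W a b) = 0"
      using h.hom_one by simp
    then show False
      using a ab by (simp add: point_difference_def point_class_in_carrier h(2) topW)
  qed
  then have "connected_space W"
    using connected_space_clopen_in by blast
  then show ?thesis
    using openin_subset [OF U] by (auto simp: connectedin_def W_def)
qed

text \<open>All point differences are images of powers of one generator of the cyclic group
  \<open>G\<close>, whereas three pieces produce two independent differences. The pieces need not be
  connected, so the third can collect all that the first two leave over.\<close>

lemma codim_1_complement_not_three_open_pieces:
  assumes U: "openin (Euclidean_space (Suc m)) U" and pcU: "path_connectedin (Euclidean_space (Suc m)) U"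
    and S: "closedin (subtopology (Euclidean_space (Suc m)) U) S"
    and S': "closedin (Euclidean_space m) S'"
    and hom: "subtopology (Euclidean_space (Suc m)) S homeomorphic_space subtopology (Euclidean_space m) S'"
    and ope: "openin (Euclidean_space (Suc m)) A" "openin (Euclidean_space (Suc m)) B"
      "openin (Euclidean_space (Suc m)) C"
    and ABC: "A \<union> B \<union> C = U - S"
    and disj: "A \<inter> B = {}" "A \<inter> C = {}" "B \<inter> C = {}"
    and ne: "A \<noteq> {}" "B \<noteq> {}" "C \<noteq> {}"
  shows False
proof -
  define W where "W = subtopology (Euclidean_space (Suc m)) (U - S)"
  define G where "G = relative_homology_group 0 (Euclidean_space m) (topspace (Euclidean_space m) - S')"
  have topW: "topspace W = U - S"
    using openin_subset [OF U] by (auto simp: W_def)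
  have "\<exists>\<psi> \<in> hom G (homology_group 0 W). \<forall>a \<in> U - S. \<forall>b \<in> U - S. point_difference W a b \<in> \<psi> ` carrier G"
    unfolding W_def G_def by (rule codim_1_complement_point_classes [OF U pcU S S' hom])
  then obtain \<psi> where \<psi>: "\<psi> \<in> hom G (homology_group 0 W)"
    and diff: "\<And>a b. \<lbrakk>a \<in> U - S; b \<in> U - S\<rbrakk> \<Longrightarrow> point_difference W a b \<in> \<psi> ` carrier G"
    by blast
  interpret \<psi>: group_hom G "homology_group 0 W" \<psi>
    by (simp add: group_hom_def group_hom_axioms_def \<psi>) (simp add: G_def)
  obtain p where "p \<in> topspace (Euclidean_space m)"
    using nontrivial_Euclidean_space by fastforce
  then have "cyclic_group G"
    unfolding G_def by (rule cyclic_relative_zeroth_homology [OF path_connected_Euclidean_space])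
  then obtain z where z: "z \<in> carrier G" "carrier G = range (\<lambda>n::int. z [^]\<^bsub>G\<^esub> n)"
    unfolding \<psi>.G.cyclic_group by blast
  have powers: "\<exists>k::int. d = \<psi> (z [^]\<^bsub>G\<^esub> k)" if "d \<in> \<psi> ` carrier G" for d
    using that unfolding z(2) by blast
  obtain a b c where abc: "a \<in> A" "b \<in> B" "c \<in> C"
    using ne by blast
  then have abc': "a \<in> U - S" "b \<in> U - S" "c \<in> U - S"
    using ABC by auto
  obtain k where k: "point_difference W a b
        = \<psi> (z [^]\<^bsub>G\<^esub> (k::int))"
    using powers [OF diff [OF abc'(1,2)]] by blast
  obtain l where l: "point_difference W a c
        = \<psi> (z [^]\<^bsub>G\<^esub> (l::int))"
    using powers [OF diff [OF abc'(1,3)]] by blast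
  \<comment> \<open>\<open>t\<close> is the value at \<open>\<psi> z\<close> of the indicator
    homomorphism of \<open>D\<close>; both differences evaluate to multiples of this one
    integer.\<close>
  have count: "\<exists>t. (if a \<in> D then 1 else 0) - (if b \<in> D then 1 else 0) = k * t
     \<and> (if a \<in> D then 1 else 0) - (if c \<in> D then 1 else 0) = l * t"
    if D: "openin W D" "closedin W D" for D
  proof -
    obtain h where h: "h \<in> hom (homology_group 0 W) integer_group"
      "\<And>a. a \<in> topspace W \<Longrightarrow> h (point_class W a) = (if a \<in> D then 1 else 0)"
      using zeroth_homology_clopen_indicator [OF D] by blast
    interpret h: group_hom "homology_group 0 W" integer_group h
      by (simp add: group_hom_def group_hom_axioms_def h(1))
    have pow: "h (\<psi> (z [^]\<^bsub>G\<^esub> (j::int))) = j * h (\<psi> z)" for j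
      using z(1) by (simp add: \<psi>.hom_int_pow h.hom_int_pow)
    have "h (point_difference W x y)
        = (if x \<in> D then 1 else 0) - (if y \<in> D then 1 else 0)"
      if "x \<in> U - S" "y \<in> U - S" for x y
      using that by (simp add: point_difference_def point_class_in_carrier h(2) topW)
    from this [OF abc'(1,2)] this [OF abc'(1,3)] show ?thesis
      unfolding k l pow by (intro exI [of _ "h (\<psi> z)"]) simp
  qed
  have "openin W A" "openin W B" "openin W C"
    unfolding W_def openin_subtopology using ope ABC
    by (metis Un_upper1 Un_upper2 inf.absorb1 le_sup_iff)+
  moreover have "topspace W - (B \<union> C) = A" "topspace W - (A \<union> C) = B"
    using disj ABC topW by auto
  ultimately have clo: "closedin W A" "closedin W B"
    using closedin_diff [OF closedin_topspace, of W "B \<union> C"] closedin_diff [OF closedin_topspace, of W "A \<union> C"]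
    by auto
  have "b \<notin> A" "c \<notin> A" "a \<notin> B" "c \<notin> B"
    using abc disj by auto
  \<comment> \<open>\<open>t\<close> comes from the indicator of \<open>A\<close> and
    \<open>s\<close> from that of \<open>B\<close>. The second equation makes \<open>s\<close>
    nonzero, the third then gives \<open>l = 0\<close>, against the first.\<close>
  then obtain s t where "1 = l * t" "-1 = k * s" "0 = l * s"
    using count [OF \<open>openin W A\<close> clo(1)] count [OF \<open>openin W B\<close> clo(2)] abc by auto
  then show False
    by auto
qed

section \<open>Neighbourhoods of a hypersurface in a manifold\<close>

lemma homeomorphic_map_subtopology_image:
  assumes "homeomorphic_map X Y f" "S \<subseteq> topspace X"
  shows "homeomorphic_map (subtopology X S) (subtopology Y (f ` S)) f"
proof (rule homeomorphic_map_subtopologies [OF assms(1)])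
  show "f ` (topspace X \<inter> S) = topspace Y \<inter> f ` S"
    using assms homeomorphic_imp_surjective_map by blast
qed

lemma connectedin_complement_proper_in_chart:
  assumes Z: "Z homeomorphic_space subtopology (Euclidean_space (Suc m)) U"
    and U: "openin (Euclidean_space (Suc m)) U" and pcZ: "path_connected_space Z"
    and S: "closedin Z S"
    and S': "closedin (Euclidean_space m) S'" "S' \<noteq> topspace (Euclidean_space m)"
    and hom: "subtopology Z S homeomorphic_space subtopology (Euclidean_space m) S'"
  shows "connectedin Z (topspace Z - S)"
proof -
  obtain f where f: "homeomorphic_map Z (subtopology (Euclidean_space (Suc m)) U) f"
    using Z homeomorphic_space by blast
  have topU: "topspace (subtopology (Euclidean_space (Suc m)) U) = U"
    using openin_subset [OF U] by auto
  have Ssub: "S \<subseteq> topspace Z"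
    using S closedin_subset by blast
  have im: "f ` topspace Z = U" "inj_on f (topspace Z)"
    using f homeomorphic_imp_surjective_map homeomorphic_imp_injective_map topU by metis+
  have clo: "closedin (subtopology (Euclidean_space (Suc m)) U) (f ` S)"
    using homeomorphic_map_closedness [OF f Ssub] S by simp
  have "path_connected_space (subtopology (Euclidean_space (Suc m)) U)"
    using homeomorphic_path_connected_space [OF Z] pcZ by simp
  then have pcU: "path_connectedin (Euclidean_space (Suc m)) U"
    using openin_subset [OF U] by (simp add: path_connectedin_def)
  have fS: "f ` S \<subseteq> U"
    using im Ssub by auto
  have "subtopology Z S homeomorphic_space subtopology (subtopology (Euclidean_space (Suc m)) U) (f ` S)"
    using homeomorphic_map_subtopology_image [OF f Ssub] homeomorphic_map_imp_homeomorphic_space by blast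
  then have "subtopology Z S homeomorphic_space subtopology (Euclidean_space (Suc m)) (f ` S)"
    using fS by (simp add: subtopology_subtopology Int_absorb1)
  then have "subtopology (Euclidean_space (Suc m)) (f ` S) homeomorphic_space subtopology Z S"
    by (subst homeomorphic_space_sym)
  then have "connectedin (Euclidean_space (Suc m)) (U - f ` S)"
    by (intro connectedin_complement_proper_codim_1 [OF U pcU clo S'] homeomorphic_space_trans [OF _ hom])
  then have "connectedin (subtopology (Euclidean_space (Suc m)) U) (U - f ` S)"
    by (simp add: connectedin_subtopology)
  moreover have "f ` (topspace Z - S) = U - f ` S"
    using im inj_on_image_set_diff [OF im(2), of "topspace Z" S] Ssub by simp
  ultimately show ?thesis
    using homeomorphic_map_connectedness [OF f, of "topspace Z - S"] by simp
qed

lemma not_three_open_pieces_in_chart: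
  assumes Z: "Z homeomorphic_space subtopology (Euclidean_space (Suc m)) U"
    and U: "openin (Euclidean_space (Suc m)) U" and pcZ: "path_connected_space Z"
    and S: "closedin Z S"
    and hom: "subtopology Z S homeomorphic_space Euclidean_space m"
    and ope: "openin Z A" "openin Z B" "openin Z C"
    and ABC: "A \<union> B \<union> C = topspace Z - S"
    and disj: "A \<inter> B = {}" "A \<inter> C = {}" "B \<inter> C = {}"
    and ne: "A \<noteq> {}" "B \<noteq> {}" "C \<noteq> {}"
  shows False
proof -
  obtain f where f: "homeomorphic_map Z (subtopology (Euclidean_space (Suc m)) U) f"
    using Z homeomorphic_space by blast
  have topU: "topspace (subtopology (Euclidean_space (Suc m)) U) = U"
    using openin_subset [OF U] by auto
  have Ssub: "S \<subseteq> topspace Z"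
    using S closedin_subset by blast
  have im: "f ` topspace Z = U" "inj_on f (topspace Z)"
    using f homeomorphic_imp_surjective_map homeomorphic_imp_injective_map topU by metis+
  have clo: "closedin (subtopology (Euclidean_space (Suc m)) U) (f ` S)"
    using homeomorphic_map_closedness [OF f Ssub] S by simp
  have "path_connected_space (subtopology (Euclidean_space (Suc m)) U)"
    using homeomorphic_path_connected_space [OF Z] pcZ by simp
  then have pcU: "path_connectedin (Euclidean_space (Suc m)) U"
    using openin_subset [OF U] by (simp add: path_connectedin_def)
  have fS: "f ` S \<subseteq> U"
    using im Ssub by auto
  have "subtopology Z S homeomorphic_space subtopology (subtopology (Euclidean_space (Suc m)) U) (f ` S)"
    using homeomorphic_map_subtopology_image [OF f Ssub] homeomorphic_map_imp_homeomorphic_space by blast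
  then have "subtopology Z S homeomorphic_space subtopology (Euclidean_space (Suc m)) (f ` S)"
    using fS by (simp add: subtopology_subtopology Int_absorb1)
  then have "subtopology (Euclidean_space (Suc m)) (f ` S) homeomorphic_space subtopology Z S"
    by (subst homeomorphic_space_sym)
  then have "subtopology (Euclidean_space (Suc m)) (f ` S) homeomorphic_space Euclidean_space m"
    by (rule homeomorphic_space_trans [OF _ hom])
  then have hom': "subtopology (Euclidean_space (Suc m)) (f ` S) homeomorphic_space
      subtopology (Euclidean_space m) (topspace (Euclidean_space m))"
    by simp
  have openf: "openin (Euclidean_space (Suc m)) (f ` T)" if "openin Z T" for T
    using homeomorphic_map_openness [OF f openin_subset [OF that]] that U by (auto intro: openin_trans_full)
  have sub: "A \<subseteq> topspace Z" "B \<subseteq> topspace Z" "C \<subseteq> topspace Z"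
    using ope openin_subset by blast+
  have disjf: "f ` P \<inter> f ` Q = {}" if "P \<inter> Q = {}" "P \<subseteq> topspace Z" "Q \<subseteq> topspace Z" for P Q
    using inj_on_image_Int [OF im(2) that(2,3)] that(1) by simp
  have "f ` A \<union> f ` B \<union> f ` C = f ` (topspace Z - S)"
    by (simp add: ABC [symmetric] image_Un)
  also have "\<dots> = U - f ` S"
    using im inj_on_image_set_diff [OF im(2), of "topspace Z" S] Ssub by simp
  finally have eq: "f ` A \<union> f ` B \<union> f ` C = U - f ` S" .
  show False
    by (rule codim_1_complement_not_three_open_pieces [OF U pcU clo closedin_topspace hom'
        openf [OF ope(1)] openf [OF ope(2)] openf [OF ope(3)] eq
        disjf [OF disj(1) sub(1,2)] disjf [OF disj(2) sub(1,3)] disjf [OF disj(3) sub(2,3)]])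
      (use ne in auto)
qed

text \<open>An open and a closed box with the same centre and radius. The open one is again a copy
  of \<open>\<real>^m\<close>; the compact one will be closed in any Hausdorff space that contains
  it.\<close>

lemma Euclidean_space_box:
  assumes B: "openin (Euclidean_space m) B" and x: "x \<in> B"
  obtains W K where "openin (Euclidean_space m) W" "x \<in> W" "W \<subseteq> K" "K \<subseteq> B"
    "compactin (Euclidean_space m) K"
    "subtopology (Euclidean_space m) W homeomorphic_space Euclidean_space m"
proof -
  let ?E = "topspace (Euclidean_space m)"
  have E: "?E = {z. \<forall>i\<ge>m. z i = 0}"
    by (simp add: topspace_Euclidean_space)
  have ETop: "Euclidean_space m = top_of_set ?E"
    by (rule Euclidean_space_eq_top_of_set)
  have xE: "x i = 0" if "i \<ge> m" for i
    using openin_subset [OF B] x that E by auto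
  have "openin (top_of_set ?E) B"
    using B ETop by simp
  then obtain T where T: "open T" "B = ?E \<inter> T"
    by (auto simp: openin_open)
  have "openin (powertop_real UNIV) T"
    using T by (simp add: euclidean_product_topology)
  then obtain Q where Q: "x \<in> Pi\<^sub>E UNIV Q" "\<forall>i. openin euclideanreal (Q i)" "Pi\<^sub>E UNIV Q \<subseteq> T"
    using product_topology_open_contains_basis [of "\<lambda>i. euclideanreal" UNIV T x] x T(2) by blast
  then have Q: "\<And>i. x i \<in> Q i" "\<And>i. open (Q i)" "\<And>z. (\<And>i. z i \<in> Q i) \<Longrightarrow> z \<in> T"
    by (auto simp: PiE_iff subset_iff)
  have "\<forall>i. \<exists>e>0. cball (x i) e \<subseteq> Q i"
    using Q open_contains_cball by metis
  then obtain e where e: "\<And>i. e i > 0" "\<And>i. cball (x i) (e i) \<subseteq> Q i"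
    by metis
  \<comment> \<open>Only the first \<open>m\<close> coordinates vary, so a common positive radius
    exists; inserting 1 keeps the minimum meaningful for \<open>m = 0\<close>.\<close>
  define \<epsilon> where "\<epsilon> = Min (insert 1 (e ` {..<m}))"
  have \<epsilon>: "\<epsilon> > 0"
    using e by (auto simp: \<epsilon>_def)
  have \<epsilon>_le: "\<epsilon> \<le> e i" if "i < m" for i
    using that by (auto simp: \<epsilon>_def)
  define W where "W = {z \<in> ?E. \<forall>i<m. \<bar>z i - x i\<bar> < \<epsilon>}"
  define K where "K = {z \<in> ?E. \<forall>i<m. \<bar>z i - x i\<bar> \<le> \<epsilon>}"
  have W_small: "\<bar>z i - x i\<bar> < \<epsilon>" if "z \<in> W" for z i
    using that \<epsilon> xE by (cases "i < m") (auto simp: W_def E)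
  show thesis
  proof
    have "open (Pi\<^sub>E UNIV (\<lambda>i. if i < m then ball (x i) \<epsilon> else UNIV))"
      by (rule open_PiE) (auto intro: finite_subset [of _ "{..<m}"] split: if_splits)
    moreover have "W = ?E \<inter> Pi\<^sub>E UNIV (\<lambda>i. if i < m then ball (x i) \<epsilon> else UNIV)"
      by (auto simp: W_def PiE_iff dist_real_def abs_minus_commute split: if_splits)
    ultimately show "openin (Euclidean_space m) W"
      using ETop by (metis openin_open_Int)
    show "x \<in> W"
      using \<epsilon> openin_subset [OF B] x by (auto simp: W_def)
    show "W \<subseteq> K"
      by (force simp: W_def K_def)
    show "K \<subseteq> B"
    proof
      fix z
      assume z: "z \<in> K"
      have "z i \<in> Q i" for i
      proof (cases "i < m")
        case True
        then have "z i \<in> cball (x i) (e i)"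
          using z \<epsilon>_le [OF True] by (force simp: K_def dist_real_def abs_minus_commute)
        then show ?thesis
          using e by blast
      next
        case False
        then have "z i = x i"
          using z xE by (auto simp: K_def E)
        then show ?thesis
          using Q by simp
      qed
      then show "z \<in> B"
        using Q(3) z T by (auto simp: K_def)
    qed
    have "K = Pi\<^sub>E UNIV (\<lambda>i. if i < m then cball (x i) \<epsilon> else {0})"
      by (auto simp: K_def E PiE_iff dist_real_def abs_minus_commute not_less split: if_splits; meson not_le)
    moreover have "compactin (powertop_real UNIV) (Pi\<^sub>E UNIV (\<lambda>i. if i < m then cball (x i) \<epsilon> else {0}))"
      by (auto simp: compactin_PiE)
    ultimately show "compactin (Euclidean_space m) K"
      by (simp add: Euclidean_space_def compactin_subtopology) (auto simp: K_def E)
    \<comment> \<open>In each coordinate, after rescaling, the mutually inverse maps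
      \<open>u / (1 - \<bar>u\<bar>)\<close> and \<open>w / (1 + \<bar>w\<bar>)\<close> between the
      interval (-1, 1) and the line. Coordinates from \<open>m\<close> on are 0 and stay 0.\<close>
    have "homeomorphic_maps (top_of_set W) (top_of_set ?E)
        (\<lambda>z i. ((z i - x i) / \<epsilon>) / (1 - \<bar>(z i - x i) / \<epsilon>\<bar>)) (\<lambda>w i. x i + \<epsilon> * (w i / (1 + \<bar>w i\<bar>)))"
      unfolding homeomorphic_maps_def
    proof (intro conjI ballI)
      have lt: "\<bar>(z i - x i) / \<epsilon>\<bar> < 1" if "z \<in> W" for z i
        using W_small [OF that, of i] \<epsilon> by simp
      have coord: "continuous_on A (\<lambda>z::nat\<Rightarrow>real. z i)" for A i
        by (rule continuous_on_subset [OF continuous_on_product_coordinates]) simp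
      have "continuous_on W (\<lambda>z i. ((z i - x i) / \<epsilon>) / (1 - \<bar>(z i - x i) / \<epsilon>\<bar>))"
      proof (rule continuous_on_coordinatewise_then_product)
        fix i
        have "\<forall>z\<in>W. 1 - \<bar>(z i - x i) / \<epsilon>\<bar> \<noteq> 0"
          using lt [of _ i] by fastforce
        then show "continuous_on W (\<lambda>z. ((z i - x i) / \<epsilon>) / (1 - \<bar>(z i - x i) / \<epsilon>\<bar>))"
          using \<epsilon> by (intro continuous_on_divide continuous_on_diff continuous_on_rabs continuous_on_const coord) auto
      qed
      then show "continuous_map (top_of_set W) (top_of_set ?E) (\<lambda>z i. ((z i - x i) / \<epsilon>) / (1 - \<bar>(z i - x i) / \<epsilon>\<bar>))"
        using xE by (auto simp: W_def E)
      have "continuous_on ?E (\<lambda>w i. x i + \<epsilon> * (w i / (1 + \<bar>w i\<bar>)))"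
      proof (rule continuous_on_coordinatewise_then_product)
        fix i
        have "1 + \<bar>w i\<bar> \<noteq> 0" for w :: "nat \<Rightarrow> real"
          using abs_ge_zero [of "w i"] by linarith
        then show "continuous_on ?E (\<lambda>w. x i + \<epsilon> * (w i / (1 + \<bar>w i\<bar>)))"
          by (intro continuous_on_divide continuous_on_add continuous_on_mult continuous_on_rabs continuous_on_const coord) auto
      qed
      moreover have "(\<lambda>i. x i + \<epsilon> * (w i / (1 + \<bar>w i\<bar>))) \<in> W" if "w \<in> ?E" for w
      proof -
        have "\<bar>\<epsilon> * (w i / (1 + \<bar>w i\<bar>))\<bar> < \<epsilon>" for i
          using \<epsilon> by (simp add: abs_mult field_simps)
        then show ?thesis
          using that xE by (auto simp: W_def E)
      qed
      ultimately show "continuous_map (top_of_set ?E) (top_of_set W) (\<lambda>w i. x i + \<epsilon> * (w i / (1 + \<bar>w i\<bar>)))"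
        by auto
      fix z
      assume "z \<in> topspace (top_of_set W)"
      then have "z \<in> W" by simp
      have "x i + \<epsilon> * (((z i - x i) / \<epsilon>) / (1 - \<bar>(z i - x i) / \<epsilon>\<bar>) / (1 + \<bar>((z i - x i) / \<epsilon>) / (1 - \<bar>(z i - x i) / \<epsilon>\<bar>)\<bar>)) = z i" for i
      proof -
        define u where "u = (z i - x i) / \<epsilon>"
        have u: "\<bar>u\<bar> < 1"
          using lt [OF \<open>z \<in> W\<close>, of i] by (simp add: u_def)
        then have "1 + \<bar>u / (1 - \<bar>u\<bar>)\<bar> = 1 / (1 - \<bar>u\<bar>)"
          by (simp add: field_simps)
        then have eq: "u / (1 - \<bar>u\<bar>) / (1 + \<bar>u / (1 - \<bar>u\<bar>)\<bar>) = u"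
          using u by simp
        have "x i + \<epsilon> * u = z i"
          using \<epsilon> by (simp add: u_def)
        then show ?thesis
          unfolding u_def [symmetric] eq .
      qed
      then show "(\<lambda>i. x i + \<epsilon> * (((z i - x i) / \<epsilon>) / (1 - \<bar>(z i - x i) / \<epsilon>\<bar>) / (1 + \<bar>((z i - x i) / \<epsilon>) / (1 - \<bar>(z i - x i) / \<epsilon>\<bar>)\<bar>))) = z"
        by blast
    next
      fix w
      have "(x i + \<epsilon> * (w i / (1 + \<bar>w i\<bar>)) - x i) / \<epsilon> / (1 - \<bar>(x i + \<epsilon> * (w i / (1 + \<bar>w i\<bar>)) - x i) / \<epsilon>\<bar>) = w i" for i
      proof -
        have pos: "1 + \<bar>w i\<bar> > 0"
          by linarith
        then have "1 - \<bar>w i / (1 + \<bar>w i\<bar>)\<bar> = 1 / (1 + \<bar>w i\<bar>)"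
          by (simp add: field_simps)
        then show ?thesis
          using \<epsilon> pos by simp
      qed
      then show "(\<lambda>i. (x i + \<epsilon> * (w i / (1 + \<bar>w i\<bar>)) - x i) / \<epsilon> / (1 - \<bar>(x i + \<epsilon> * (w i / (1 + \<bar>w i\<bar>)) - x i) / \<epsilon>\<bar>)) = w"
        by blast
    qed
    then show "subtopology (Euclidean_space m) W homeomorphic_space Euclidean_space m"
      using ETop subtopology_Euclidean_space [of W m]
      by (metis (no_types, lifting) W_def homeomorphic_maps_imp_homeomorphic_space mem_Collect_eq subsetI)
  qed
qed

text \<open>A box \<open>W\<close> around \<open>y\<close> in a chart of \<open>Y\<close> is cut out
  of \<open>Y\<close> by an open set of \<open>X\<close>, and a compact box \<open>D\<close> makes
  it relatively closed there. Passing to the path component of \<open>y\<close> loses nothing of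
  \<open>W\<close>, which is itself path-connected.\<close>

lemma hypersurface_neighbourhood:
  assumes X: "topological_manifold (Suc m) X" and Y: "submanifold m Y X"
    and y: "y \<in> Y" and G: "openin X G" "y \<in> G"
  obtains N U where "openin X N" "y \<in> N" "N \<subseteq> G" "path_connectedin X N"
    "openin (Euclidean_space (Suc m)) U"
    "subtopology X N homeomorphic_space subtopology (Euclidean_space (Suc m)) U"
    "closedin (subtopology X N) (N \<inter> Y)"
    "subtopology X (N \<inter> Y) homeomorphic_space Euclidean_space m"
proof -
  have YX: "Y \<subseteq> topspace X"
    using Y by (simp add: submanifold_def)
  then obtain U0 where U0: "openin X U0" "y \<in> U0" "subtopology X U0 homeomorphic_space Euclidean_space (Suc m)"
    using X y unfolding topological_manifold_def by blast
  obtain f where f: "homeomorphic_map (subtopology X U0) (Euclidean_space (Suc m)) f"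
    using U0(3) homeomorphic_space by blast
  have "y \<in> topspace (subtopology X Y)"
    using y YX by auto
  then obtain V where V: "openin (subtopology X Y) V" "y \<in> V"
    "subtopology (subtopology X Y) V homeomorphic_space Euclidean_space m"
    using Y unfolding submanifold_def topological_manifold_def by blast
  have VY: "V \<subseteq> Y"
    using openin_subset [OF V(1)] by auto
  then have subV: "subtopology (subtopology X Y) V = subtopology X V"
    by (simp add: subtopology_subtopology Int_absorb1)
  have topV: "topspace (subtopology X V) = V"
    using VY YX by auto
  obtain p where p: "homeomorphic_map (subtopology X V) (Euclidean_space m) p"
    using V(3) homeomorphic_space unfolding subV by blast
  have pV: "p ` V = topspace (Euclidean_space m)" "inj_on p V"
    using homeomorphic_imp_surjective_map [OF p] homeomorphic_imp_injective_map [OF p] topV by simp_all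
  define R where "R = V \<inter> (U0 \<inter> G)"
  have "openin (subtopology X V) R"
    unfolding R_def by (intro openin_subtopology_Int2 openin_Int U0 G)
  then have "openin (Euclidean_space m) (p ` R)"
    using homeomorphic_map_openness [OF p openin_subset] by blast
  moreover have "p y \<in> p ` R"
    using U0 G V by (auto simp: R_def)
  ultimately obtain W' K where W': "openin (Euclidean_space m) W'" "p y \<in> W'" "W' \<subseteq> K" "K \<subseteq> p ` R"
    "compactin (Euclidean_space m) K"
    "subtopology (Euclidean_space m) W' homeomorphic_space Euclidean_space m"
    by (rule Euclidean_space_box)
  define W where "W = {v \<in> V. p v \<in> W'}"
  define D where "D = {v \<in> V. p v \<in> K}"
  have "W' \<subseteq> topspace (Euclidean_space m)" "K \<subseteq> topspace (Euclidean_space m)"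
    using W' openin_subset compactin_subset_topspace by blast+
  then have "W' \<subseteq> p ` V" "K \<subseteq> p ` V"
    by (simp_all add: pV(1))
  then have pW: "p ` W = W'" and pD: "p ` D = K"
    by (auto simp: W_def D_def)
  have WD: "W \<subseteq> D" "D \<subseteq> V" "y \<in> W"
    using W' V by (auto simp: W_def D_def)
  have DR: "D \<subseteq> R"
    using W'(4) pV(2) by (fastforce simp: D_def R_def inj_on_def)
  have "openin (subtopology X V) W"
    using homeomorphic_map_openness [OF p, of W] W'(1) pW WD topV by auto
  then have "openin (subtopology X Y) W"
    using V(1) subV openin_trans_full by metis
  then obtain T where T: "openin X T" "W = T \<inter> Y"
    by (auto simp: openin_subtopology)
  have "compactin (subtopology X V) D"
    using homeomorphic_map_compactness [OF p, of D] W'(5) pD WD topV by auto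
  \<comment> \<open>\<open>Y\<close> need not be closed in \<open>X\<close>; the compact piece \<open>D\<close> of \<open>Y\<close> is, and it agrees with \<open>Y\<close> on \<open>N0\<close>.\<close>
  then have cloD: "closedin X D"
    using X by (simp add: compactin_subtopology compactin_imp_closedin topological_manifold_def)
  define N0 where "N0 = T \<inter> (U0 \<inter> G)"
  have N0: "openin X N0" "N0 \<subseteq> U0" "N0 \<subseteq> G"
    using T U0 G by (auto simp: N0_def)
  have N0Y: "N0 \<inter> Y = W"
    using T WD DR by (auto simp: N0_def R_def)
  have N0D: "N0 \<inter> D = W"
    using N0Y WD VY by blast
  have homW: "subtopology X W homeomorphic_space Euclidean_space m"
  proof -
    have "homeomorphic_map (subtopology (subtopology X V) W) (subtopology (Euclidean_space m) (p ` W)) p"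
      using WD topV by (intro homeomorphic_map_subtopology_image [OF p]) auto
    moreover have "subtopology (subtopology X V) W = subtopology X W"
      using WD by (simp add: subtopology_subtopology Int_absorb1 subset_trans)
    ultimately have "subtopology X W homeomorphic_space subtopology (Euclidean_space m) W'"
      using homeomorphic_map_imp_homeomorphic_space pW by metis
    then show ?thesis
      by (rule homeomorphic_space_trans [OF _ W'(6)])
  qed
  then have "path_connected_space (subtopology X W)"
    using homeomorphic_path_connected_space path_connected_Euclidean_space by blast
  then have "path_connectedin X W"
    using WD VY YX by (auto simp: path_connectedin_def)
  then have pcW: "path_connectedin (subtopology X N0) W"
    using N0Y by (auto simp: path_connectedin_subtopology)
  have "locally_path_connected_space (subtopology X U0)"
    using homeomorphic_locally_path_connected_space [OF U0(3)] locally_path_connected_Euclidean_space by blast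
  moreover have "openin (subtopology X U0) N0"
    using N0 U0 by (simp add: openin_open_subtopology)
  ultimately have "locally_path_connected_space (subtopology (subtopology X U0) N0)"
    by (rule locally_path_connected_space_open_subset)
  then have lpc: "locally_path_connected_space (subtopology X N0)"
    using N0 by (simp add: subtopology_subtopology Int_absorb1)
  \<comment> \<open>Path-connectedness of \<open>N\<close> is needed by the local results. As
    \<open>N0\<close> is locally path-connected, the path component is open.\<close>
  define N where "N = Collect (path_component_of (subtopology X N0) y)"
  have "openin (subtopology X N0) N"
    unfolding N_def by (rule openin_path_component_of_locally_path_connected_space [OF lpc])
  then have N: "openin X N" "N \<subseteq> N0"
    using N0(1) openin_open_subtopology by blast+
  have "path_connectedin (subtopology X N0) N"
    unfolding N_def by (rule path_connectedin_path_component_of)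
  then have pcN: "path_connectedin X N"
    by (simp add: path_connectedin_subtopology)
  have WN: "W \<subseteq> N"
    unfolding N_def using path_component_of_maximal [OF pcW WD(3)] .
  then have NY: "N \<inter> Y = W"
    using N0Y N by blast
  have topN: "N \<subseteq> topspace (subtopology X U0)"
    using openin_subset [OF N(1)] N N0 by auto
  have NU0: "N \<subseteq> U0"
    using N N0 by blast
  show thesis
  proof
    show "openin X N" "y \<in> N" "N \<subseteq> G" "path_connectedin X N"
      using N pcN WN WD N0 by auto
    have "openin (subtopology X U0) N"
      using N U0 NU0 by (simp add: openin_open_subtopology)
    then show "openin (Euclidean_space (Suc m)) (f ` N)"
      using homeomorphic_map_openness [OF f topN] by simp
    have "homeomorphic_map (subtopology (subtopology X U0) N) (subtopology (Euclidean_space (Suc m)) (f ` N)) f"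
      by (rule homeomorphic_map_subtopology_image [OF f topN])
    then show "subtopology X N homeomorphic_space subtopology (Euclidean_space (Suc m)) (f ` N)"
      using homeomorphic_map_imp_homeomorphic_space NU0
      by (fastforce simp: subtopology_subtopology Int_absorb1)
    have "N \<inter> Y = D \<inter> N"
      using NY N0D N WD WN by blast
    then show "closedin (subtopology X N) (N \<inter> Y)"
      using cloD closedin_subtopology by blast
    show "subtopology X (N \<inter> Y) homeomorphic_space Euclidean_space m"
      using homW NY by simp
  qed
qed

text \<open>A homeomorphism from \<open>W\<close> to \<open>\<real>^m\<close> turns \<open>S\<close>
  into a proper closed subset of \<open>\<real>^m\<close>, and such a set does not separate a chart
  domain.\<close>

lemma hypersurface_neighbourhood_connectedin_Diff:
  assumes N: "openin X N" "path_connectedin X N"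
    and U: "openin (Euclidean_space (Suc m)) U"
      "subtopology X N homeomorphic_space subtopology (Euclidean_space (Suc m)) U"
    and W: "closedin (subtopology X N) W" "subtopology X W homeomorphic_space Euclidean_space m"
    and S: "closedin (subtopology X N) S" "S \<subset> W"
  shows "connectedin X (N - S)"
proof -
  have NX: "topspace (subtopology X N) = N"
    using N openin_subset by fastforce
  then have WN: "W \<subseteq> N"
    using closedin_subset [OF W(1)] by simp
  have topW: "topspace (subtopology X W) = W"
    using WN openin_subset [OF N(1)] by auto
  obtain p where p: "homeomorphic_map (subtopology X W) (Euclidean_space m) p"
    using W(2) homeomorphic_space by blast
  have pW: "p ` W = topspace (Euclidean_space m)" "inj_on p W"
    using homeomorphic_imp_surjective_map [OF p] homeomorphic_imp_injective_map [OF p] topW by simp_all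
  have SW: "S \<subseteq> W"
    using S by blast
  obtain C where "closedin X C" "S = C \<inter> N"
    using S(1) by (auto simp: closedin_subtopology)
  then have cloS: "closedin (subtopology X W) S"
    using SW WN unfolding closedin_subtopology by blast
  then have clo: "closedin (Euclidean_space m) (p ` S)"
    using homeomorphic_map_closedness [OF p closedin_subset [OF cloS]] by simp
  have ne: "p ` S \<noteq> topspace (Euclidean_space m)"
    using S(2) pW by (metis inj_on_image_eq_iff psubset_imp_subset order_less_irrefl subset_refl)
  have "homeomorphic_map (subtopology (subtopology X W) S) (subtopology (Euclidean_space m) (p ` S)) p"
    using SW topW by (intro homeomorphic_map_subtopology_image [OF p]) simp
  moreover have "subtopology (subtopology X W) S = subtopology (subtopology X N) S"
    using SW WN by (simp add: subtopology_subtopology Int_absorb1 subset_trans)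
  ultimately have hom: "subtopology (subtopology X N) S homeomorphic_space subtopology (Euclidean_space m) (p ` S)"
    using homeomorphic_map_imp_homeomorphic_space by metis
  have "path_connected_space (subtopology X N)"
    using N by (simp add: path_connectedin_def)
  then have "connectedin (subtopology X N) (topspace (subtopology X N) - S)"
    by (rule connectedin_complement_proper_in_chart [OF U(2,1) _ S(1) clo ne hom])
  then show ?thesis
    unfolding NX connectedin_subtopology by blast
qed

lemma hypersurface_neighbourhood_not_three_open_pieces:
  assumes N: "openin X N" "path_connectedin X N"
    and U: "openin (Euclidean_space (Suc m)) U"
      "subtopology X N homeomorphic_space subtopology (Euclidean_space (Suc m)) U"
    and W: "closedin (subtopology X N) W" "subtopology X W homeomorphic_space Euclidean_space m"
    and ope: "openin X A" "openin X B" "openin X C"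
    and ABC: "A \<union> B \<union> C = N - W"
    and disj: "A \<inter> B = {}" "A \<inter> C = {}" "B \<inter> C = {}"
    and ne: "A \<noteq> {}" "B \<noteq> {}" "C \<noteq> {}"
  shows False
proof -
  have NX: "topspace (subtopology X N) = N"
    using N openin_subset by fastforce
  then have WN: "W \<subseteq> N"
    using closedin_subset [OF W(1)] by simp
  have "path_connected_space (subtopology X N)"
    using N by (simp add: path_connectedin_def)
  moreover have "subtopology (subtopology X N) W homeomorphic_space Euclidean_space m"
    using W(2) WN by (simp add: subtopology_subtopology Int_absorb1)
  moreover have "openin (subtopology X N) A" "openin (subtopology X N) B" "openin (subtopology X N) C"
    using ope ABC N by (auto simp: openin_open_subtopology)
  moreover have "A \<union> B \<union> C = topspace (subtopology X N) - W"
    using ABC NX by simp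
  ultimately show False
    using not_three_open_pieces_in_chart [OF U(2,1) _ W(1)] disj ne by metis
qed

lemma Euclidean_space_hyperplane_separates:
  assumes "m > 0"
  shows "\<not> connectedin (Euclidean_space m) (topspace (Euclidean_space m) - {x. x 0 = 0})"
proof
  assume "connectedin (Euclidean_space m) (topspace (Euclidean_space m) - {x. x 0 = 0})"
  moreover have "continuous_map (Euclidean_space m) euclideanreal (\<lambda>x. x 0)"
    unfolding Euclidean_space_def
    by (intro continuous_map_from_subtopology continuous_map_product_projection) auto
  ultimately have "connected ((\<lambda>x. x 0) ` (topspace (Euclidean_space m) - {x. x 0 = 0}) :: real set)"
    using connectedin_continuous_map_image by fastforce
  moreover have "(\<lambda>i. if i = 0 then c else 0) \<in> topspace (Euclidean_space m)" for c :: real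
    using assms by (auto simp: topspace_Euclidean_space)
  then have "c \<in> (\<lambda>x. x 0) ` (topspace (Euclidean_space m) - {x. x 0 = 0})" if "c \<noteq> 0" for c :: real
    using that by (intro image_eqI [where x = "\<lambda>i. if i = 0 then c else 0"]) auto
  then have "-1 \<in> (\<lambda>x. x 0) ` (topspace (Euclidean_space m) - {x. x 0 = (0::real)})"
    "1 \<in> (\<lambda>x. x 0) ` (topspace (Euclidean_space m) - {x. x 0 = (0::real)})"
    by auto
  ultimately have "0 \<in> (\<lambda>x. x 0) ` (topspace (Euclidean_space m) - {x. x 0 = (0::real)})"
    by (rule connectedD_interval) auto
  then show False
    by auto
qed

text \<open>A case of invariance of dimension; it serves to show that a hypersurface contains no
  nonempty open set.\<close>

lemma hypersurface_neighbourhood_not_hypersurface: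
  assumes N: "openin X N" "path_connectedin X N"
    and U: "openin (Euclidean_space (Suc m)) U"
      "subtopology X N homeomorphic_space subtopology (Euclidean_space (Suc m)) U"
    and hom: "subtopology X N homeomorphic_space Euclidean_space m" and "m > 0"
  shows False
proof -
  have NX: "topspace (subtopology X N) = N"
    using N openin_subset by fastforce
  obtain p where p: "homeomorphic_map (subtopology X N) (Euclidean_space m) p"
    using hom homeomorphic_space by blast
  have pN: "p ` N = topspace (Euclidean_space m)" "inj_on p N"
    using homeomorphic_imp_surjective_map [OF p] homeomorphic_imp_injective_map [OF p] NX by simp_all
  \<comment> \<open>If a hypersurface filled up the open set \<open>N\<close>, then a hyperplane, being a proper closed subset of it, would separate \<open>N\<close>.\<close>
  define H where "H = {x \<in> topspace (Euclidean_space m). x 0 = 0}"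
  define S where "S = {x \<in> N. p x \<in> H}"
  have "H \<subseteq> p ` N"
    by (auto simp: pN H_def)
  then have pS: "p ` S = H"
    by (auto simp: S_def)
  have "continuous_map (Euclidean_space m) euclideanreal (\<lambda>x. x 0)"
    unfolding Euclidean_space_def
    by (intro continuous_map_from_subtopology continuous_map_product_projection) auto
  then have "closedin (Euclidean_space m) {x \<in> topspace (Euclidean_space m). x 0 \<in> {0::real}}"
    by (rule closedin_continuous_map_preimage) simp
  then have "closedin (Euclidean_space m) H"
    by (simp add: H_def)
  then have clo: "closedin (subtopology X N) S"
    using homeomorphic_map_closedness [OF p, of S] NX by (simp add: pS) (auto simp: S_def)
  have "(\<lambda>i. if i = 0 then 1 else 0) \<in> topspace (Euclidean_space m) - H"
    using \<open>m > 0\<close> by (auto simp: topspace_Euclidean_space H_def)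
  then have "p ` S \<noteq> p ` N"
    by (auto simp: pN pS)
  then have "S \<subset> N"
    by (auto simp: S_def)
  moreover have "closedin (subtopology X N) N"
    using closedin_topspace NX by metis
  ultimately have "connectedin X (N - S)"
    using hypersurface_neighbourhood_connectedin_Diff [OF N U _ hom clo] by blast
  then have "connectedin (subtopology X N) (N - S)"
    by (simp add: connectedin_subtopology)
  then have "connectedin (Euclidean_space m) (p ` (N - S))"
    using homeomorphic_map_connectedness [OF p, of "N - S"] NX by auto
  moreover have "p ` (N - S) = topspace (Euclidean_space m) - {x. x 0 = 0}"
    by (auto simp: S_def H_def simp flip: pN(1))
  ultimately show False
    using Euclidean_space_hyperplane_separates [OF \<open>m > 0\<close>] by simp
qed

section \<open>Components of the complement of a hypersurface\<close>

lemma topological_manifold_connected_neighbourhood: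
  assumes X: "topological_manifold n X" and G: "openin X G" "x \<in> G"
  obtains T where "openin X T" "x \<in> T" "T \<subseteq> G" "connectedin X T"
proof -
  obtain U where U: "openin X U" "x \<in> U" "subtopology X U homeomorphic_space Euclidean_space n"
    using X G openin_subset unfolding topological_manifold_def by blast
  have "locally_path_connected_space (subtopology X U)"
    using homeomorphic_locally_path_connected_space [OF U(3)] locally_path_connected_Euclidean_space by blast
  moreover have "openin (subtopology X U) (U \<inter> G)"
    using U G by (simp add: openin_open_subtopology openin_Int)
  ultimately obtain T where "openin (subtopology X U) T" "path_connectedin (subtopology X U) T"
     "x \<in> T" "T \<subseteq> U \<inter> G"
    using U(2) G(2) unfolding locally_path_connected_space by blast
  then have "openin X T" "x \<in> T" "T \<subseteq> G" "connectedin X T"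
    using U(1) by (auto simp: openin_open_subtopology path_connectedin_subtopology path_connectedin_imp_connectedin)
  then show thesis
    by (rule that)
qed

text \<open>\<open>Y\<close> need not be closed, so components of its complement need not be open in
  \<open>X\<close>. Inside an open subset of the complement they are, by local
  connectedness.\<close>

lemma openin_component_Int:
  assumes X: "topological_manifold n X" and P: "openin X P" "P \<subseteq> D"
    and C: "C \<in> connected_components_of (subtopology X D)"
  shows "openin X (C \<inter> P)"
proof (subst openin_subopen, intro ballI)
  fix x
  assume x: "x \<in> C \<inter> P"
  then obtain T where T: "openin X T" "x \<in> T" "T \<subseteq> P" "connectedin X T"
    using topological_manifold_connected_neighbourhood [OF X P(1)] by blast
  then have "connectedin (subtopology X D) T"
    using P by (auto simp: connectedin_subtopology)
  then have "T \<subseteq> C"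
    using connected_components_of_maximal [OF C] T(2) x by (auto simp: disjnt_iff)
  then show "\<exists>T. openin X T \<and> x \<in> T \<and> T \<subseteq> C \<inter> P"
    using T by blast
qed

text \<open>Components are closed in their own space, so the closure in \<open>X\<close> only adds
  points outside \<open>D\<close>.\<close>

lemma closure_of_component_Int:
  assumes "C \<in> connected_components_of (subtopology X D)" "D \<subseteq> topspace X"
  shows "X closure_of C \<inter> D = C"
proof -
  have "closedin (subtopology X D) C"
    using assms closedin_connected_components_of by blast
  then have "C = subtopology X D closure_of C" "C \<subseteq> D"
    using closure_of_closedin closedin_subset by fastforce+
  then show ?thesis
    by (metis closure_of_subtopology inf.absorb_iff2 inf_commute)
qed

text \<open>Suppose that the closure of \<open>C\<close> contains only a proper part
  \<open>S\<close> of \<open>N \<inter> Y\<close>. Then \<open>N - S\<close> is connected, yet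
  \<open>C \<inter> N\<close> is a nonempty proper clopen subset of it. So near each of its points
  the closure of \<open>C\<close> contains all of \<open>Y\<close>.\<close>

lemma closure_of_component_openin_hypersurface:
  assumes X: "topological_manifold (Suc m) X" and Y: "submanifold m Y X"
    and C: "C \<in> connected_components_of (subtopology X (topspace X - Y))"
  shows "openin (subtopology X Y) (X closure_of C \<inter> Y)"
proof (subst openin_subopen, intro ballI)
  fix y
  assume y: "y \<in> X closure_of C \<inter> Y"
  have CX: "C \<subseteq> topspace X - Y"
    using connected_components_of_subset [OF C] by auto
  have yX: "y \<in> topspace X"
    using y closure_of_subset_topspace by fastforce
  obtain N U where N: "openin X N" "y \<in> N" "N \<subseteq> topspace X" "path_connectedin X N"
    and U: "openin (Euclidean_space (Suc m)) U"
    "subtopology X N homeomorphic_space subtopology (Euclidean_space (Suc m)) U"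
    and W: "closedin (subtopology X N) (N \<inter> Y)"
    "subtopology X (N \<inter> Y) homeomorphic_space Euclidean_space m"
    by (rule hypersurface_neighbourhood [OF X Y _ openin_topspace yX]) (use y in blast)+
  define S where "S = X closure_of C \<inter> (N \<inter> Y)"
  have "N \<inter> Y \<subseteq> X closure_of C"
  proof (rule ccontr)
    assume not: "\<not> N \<inter> Y \<subseteq> X closure_of C"
    have "closedin (subtopology X N) (X closure_of C \<inter> N)"
      using closedin_closure_of closedin_subtopology by blast
    moreover have "S = (X closure_of C \<inter> N) \<inter> (N \<inter> Y)"
      by (auto simp: S_def)
    ultimately have "closedin (subtopology X N) S"
      using W(1) by (simp add: closedin_Int)
    moreover have "S \<subset> N \<inter> Y"
      using not by (auto simp: S_def)
    ultimately have "connectedin X (N - S)"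
      by (rule hypersurface_neighbourhood_connectedin_Diff [OF N(1,4) U W])
    then have con: "connected_space (subtopology X (N - S))"
      by (simp add: connectedin_def)
    have top: "topspace (subtopology X (N - S)) = N - S"
      using N by auto
    have "openin (subtopology X N) (N - N \<inter> Y)"
      using W(1) N(3) by (metis closedin_def topspace_subtopology_subset)
    then have "openin X (N - Y)"
      using N(1) by (simp add: openin_open_subtopology Diff_Int)
    then have "openin X (C \<inter> (N - Y))"
      using openin_component_Int [OF X _ _ C] N by blast
    moreover have "C \<inter> (N - Y) = C \<inter> N"
      using CX by blast
    moreover have "C \<inter> N \<subseteq> N - S"
      using CX by (auto simp: S_def)
    ultimately have ope: "openin (subtopology X (N - S)) (C \<inter> N)"
      by (metis inf.absorb1 openin_subtopology)
    have "X closure_of C \<inter> (topspace X - Y) = C"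
      by (rule closure_of_component_Int [OF C]) auto
    \<comment> \<open>Inside \<open>N\<close>, the points that the closure adds to \<open>C\<close>
      lie in \<open>Y\<close> and hence in \<open>S\<close>, which has been removed.\<close>
    then have "C \<inter> N = X closure_of C \<inter> (N - S)"
      using N CX by (auto simp: S_def)
    then have clo: "closedin (subtopology X (N - S)) (C \<inter> N)"
      using closedin_closure_of closedin_subtopology by blast
    have "C \<inter> N \<noteq> {}"
      using y N by (auto simp: in_closure_of)
    \<comment> \<open>A point of \<open>N \<inter> Y\<close> outside the closure of \<open>C\<close>
      belongs to \<open>N - S\<close> but not to \<open>C\<close>.\<close>
    moreover have "C \<inter> N \<noteq> N - S"
      using not CX by (auto simp: S_def)
    ultimately show False
      using con ope clo top unfolding connected_space_clopen_in by metis
  qed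
  then show "\<exists>T. openin (subtopology X Y) T \<and> y \<in> T \<and> T \<subseteq> X closure_of C \<inter> Y"
    using N y by (intro exI [of _ "N \<inter> Y"]) (auto simp: openin_subtopology)
qed

lemma clopen_eq_Union_components:
  assumes "openin X K" "closedin X K"
  shows "\<exists>\<K> \<subseteq> connected_components_of X. K = \<Union>\<K>"
proof (intro exI conjI)
  let ?\<K> = "{Q \<in> connected_components_of X. Q \<subseteq> K}"
  show "?\<K> \<subseteq> connected_components_of X"
    by blast
  show "K = \<Union>?\<K>"
  proof
    show "K \<subseteq> \<Union>?\<K>"
    proof
      fix x
      assume x: "x \<in> K"
      then have "x \<in> \<Union>(connected_components_of X)"
        using openin_subset [OF assms(1)] by (auto simp: Union_connected_components_of)
      then obtain Q where Q: "Q \<in> connected_components_of X" "x \<in> Q"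
        by blast
      then have "Q \<subseteq> K"
        using connectedin_clopen_cases [OF connectedin_connected_components_of [OF Q(1)] assms(2,1)] x
        by (auto simp: disjnt_iff)
      then show "x \<in> \<Union>?\<K>"
        using Q by blast
    qed
  qed blast
qed

text \<open>Finiteness has to be concluded as well, since \<open>card\<close> of an infinite set is
  0.\<close>

lemma card_le_2_if_no_three_distinct:
  assumes "\<And>a b c. \<lbrakk>a \<in> M; b \<in> M; c \<in> M; a \<noteq> b; a \<noteq> c; b \<noteq> c\<rbrakk> \<Longrightarrow> False"
  shows "finite M \<and> card M \<le> 2"
proof (rule ccontr)
  assume not: "\<not> ?thesis"
  have "\<exists>T. T \<subseteq> M \<and> card T = 3"
  proof (cases "finite M")
    case True
    with not have "3 \<le> card M"
      by simp
    then show ?thesis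
      by (rule obtain_subset_with_card_n) blast
  next
    case False
    then show ?thesis
      using infinite_arbitrarily_large [of M 3] by blast
  qed
  then obtain a b c where "{a, b, c} \<subseteq> M" "a \<noteq> b" "b \<noteq> c" "a \<noteq> c"
    by (auto simp: card_3_iff)
  then show False
    using assms by blast
qed

text \<open>Three components meeting \<open>N\<close> would split \<open>N - Y\<close> into three
  nonempty open pieces: two of the components and the union of all others.\<close>

lemma components_meeting_hypersurface_neighbourhood:
  assumes X: "topological_manifold (Suc m) X"
    and N: "openin X N" "path_connectedin X N"
    and U: "openin (Euclidean_space (Suc m)) U"
      "subtopology X N homeomorphic_space subtopology (Euclidean_space (Suc m)) U"
    and W: "closedin (subtopology X N) (N \<inter> Y)" "subtopology X (N \<inter> Y) homeomorphic_space Euclidean_space m"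
  defines "M \<equiv> {C \<in> connected_components_of (subtopology X (topspace X - Y)). C \<inter> N \<noteq> {}}"
  shows "finite M \<and> card M \<le> 2"
proof (rule card_le_2_if_no_three_distinct)
  fix A B C
  assume ABC: "A \<in> M" "B \<in> M" "C \<in> M" "A \<noteq> B" "A \<noteq> C" "B \<noteq> C"
  let ?\<C> = "connected_components_of (subtopology X (topspace X - Y))"
  have NX: "N \<subseteq> topspace X"
    using N openin_subset by blast
  have comp: "A \<in> ?\<C>" "B \<in> ?\<C>" "C \<in> ?\<C>"
    using ABC by (auto simp: M_def)
  have subs: "Q \<subseteq> topspace X - Y" if "Q \<in> ?\<C>" for Q
    using connected_components_of_subset [OF that] by auto
  have disj: "P \<inter> Q = {}" if "P \<in> ?\<C>" "Q \<in> ?\<C>" "P \<noteq> Q" for P Q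
    using pairwise_disjoint_connected_components_of that by (metis disjnt_def pairwiseD)
  have "openin (subtopology X N) (N - N \<inter> Y)"
    using W(1) NX by (metis closedin_def topspace_subtopology_subset)
  then have "openin X (N - Y)"
    using N(1) by (simp add: openin_open_subtopology Diff_Int)
  then have ope: "openin X (Q \<inter> (N - Y))" if "Q \<in> ?\<C>" for Q
    using openin_component_Int [OF X _ _ that] NX by blast
  \<comment> \<open>All remaining components are collected, so that the three pieces cover
    \<open>N - Y\<close>; the component \<open>C\<close> makes \<open>R\<close> nonempty.\<close>
  define R where "R = (\<Union>Q \<in> ?\<C> - {A, B}. Q \<inter> (N - Y))"
  have "openin X R"
    unfolding R_def using ope by blast
  have cover: "\<Union>?\<C> = topspace X - Y"
    using Union_connected_components_of [of "subtopology X (topspace X - Y)"] by auto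
  have "A \<inter> (N - Y) \<union> B \<inter> (N - Y) \<union> R = N - N \<inter> Y"
  proof
    show "N - N \<inter> Y \<subseteq> A \<inter> (N - Y) \<union> B \<inter> (N - Y) \<union> R"
      using cover NX unfolding R_def by blast
  qed (auto simp: R_def)
  moreover have "A \<inter> (N - Y) \<inter> (B \<inter> (N - Y)) = {}"
    using disj [OF comp(1,2)] ABC by blast
  moreover have "A \<inter> (N - Y) \<inter> R = {}" "B \<inter> (N - Y) \<inter> R = {}"
    using disj [OF comp(1)] disj [OF comp(2)] unfolding R_def by blast+
  moreover have "A \<inter> (N - Y) \<noteq> {}" "B \<inter> (N - Y) \<noteq> {}"
    using ABC subs comp unfolding M_def by blast+
  moreover have "R \<noteq> {}"
  proof -
    have "C \<inter> (N - Y) \<noteq> {}"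
      using ABC subs comp unfolding M_def by blast
    then show ?thesis
      using ABC comp unfolding R_def by blast
  qed
  ultimately show False
    using hypersurface_neighbourhood_not_three_open_pieces [OF N U W ope [OF comp(1)] ope [OF comp(2)] \<open>openin X R\<close>]
    by blast
qed

text \<open>Only finitely many components come near \<open>y\<close>, so the union of their closures
  is closed. If it missed \<open>y\<close>, removing it from \<open>N\<close> would leave an open
  neighbourhood of \<open>y\<close> inside \<open>Y\<close>, which the dimension forbids.\<close>

lemma hypersurface_in_closure_of_component:
  assumes X: "topological_manifold (Suc m) X" and Y: "submanifold m Y X" and "m > 0"
    and N: "openin X N" "y \<in> N" and y: "y \<in> Y"
    and fin: "finite {C \<in> connected_components_of (subtopology X (topspace X - Y)). C \<inter> N \<noteq> {}}"
  obtains C where "C \<in> connected_components_of (subtopology X (topspace X - Y))" "y \<in> X closure_of C"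
proof (rule ccontr)
  assume "\<not> thesis"
  with that have not: "y \<notin> X closure_of C" if "C \<in> connected_components_of (subtopology X (topspace X - Y))" for C
    using \<open>C \<in> _\<close> by blast
  let ?M = "{C \<in> connected_components_of (subtopology X (topspace X - Y)). C \<inter> N \<noteq> {}}"
  define G where "G = N - (\<Union>C\<in>?M. X closure_of C)"
  have "closedin X (\<Union>C\<in>?M. X closure_of C)"
    using fin by (intro closedin_Union) auto
  then have G: "openin X G" "y \<in> G"
    using N not by (auto simp: G_def)
  have "G \<subseteq> Y"
  proof
    fix x
    assume x: "x \<in> G"
    show "x \<in> Y"
    proof (rule ccontr)
      assume "x \<notin> Y"
      then have "x \<in> \<Union>(connected_components_of (subtopology X (topspace X - Y)))"
        using openin_subset [OF G(1)] x by (auto simp: Union_connected_components_of)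
      then obtain C where C: "C \<in> connected_components_of (subtopology X (topspace X - Y))" "x \<in> C"
        by blast
      then have "C \<subseteq> topspace X"
        using connected_components_of_subset by fastforce
      then have "x \<in> X closure_of C"
        using C closure_of_subset by blast
      then show False
        using x C unfolding G_def by blast
    qed
  qed
  obtain N' U where N': "openin X N'" "N' \<subseteq> G" "path_connectedin X N'"
    and U: "openin (Euclidean_space (Suc m)) U"
    "subtopology X N' homeomorphic_space subtopology (Euclidean_space (Suc m)) U"
    and W: "subtopology X (N' \<inter> Y) homeomorphic_space Euclidean_space m"
    by (rule hypersurface_neighbourhood [OF X Y y G])
  have "N' \<inter> Y = N'"
    using N' \<open>G \<subseteq> Y\<close> by blast
  then show False
    using hypersurface_neighbourhood_not_hypersurface [OF N'(1,3) U _ \<open>m > 0\<close>] W by simp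
qed

text \<open>Every component is shown to meet the neighbourhood \<open>N\<close> of a single point of
  \<open>Y\<close>, which at most two components can do.\<close>

lemma connected_hypersurface_complement_components:
  assumes X: "topological_manifold (Suc m) X" and Y: "submanifold m Y X" and "m > 0"
    and conX: "connected_space X" and conY: "connected_space (subtopology X Y)"
  defines "\<C> \<equiv> connected_components_of (subtopology X (topspace X - Y))"
  shows "finite \<C> \<and> card \<C> \<le> 2"
proof (cases "Y = {}")
  case True
  \<comment> \<open>The complement is now the connected space \<open>X\<close> itself, which has at
    most one component.\<close>
  then obtain S where "\<C> \<subseteq> {S}"
    using conX connected_space_iff_components_subset_singleton [of X] by (auto simp: \<C>_def)
  then show ?thesis
    using card_mono [of "{S}" \<C>] finite_subset [of \<C> "{S}"] by simp
next
  case False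
  then obtain y where y: "y \<in> Y"
    by blast
  have YX: "Y \<subseteq> topspace X"
    using Y by (simp add: submanifold_def)
  then have yX: "y \<in> topspace X"
    using y by blast
  have topY: "topspace (subtopology X Y) = Y"
    using YX by auto
  obtain N U where N: "openin X N" "y \<in> N" "path_connectedin X N"
    and U: "openin (Euclidean_space (Suc m)) U"
    "subtopology X N homeomorphic_space subtopology (Euclidean_space (Suc m)) U"
    and W: "closedin (subtopology X N) (N \<inter> Y)"
    "subtopology X (N \<inter> Y) homeomorphic_space Euclidean_space m"
    by (rule hypersurface_neighbourhood [OF X Y y openin_topspace yX])
  have M: "finite {C \<in> \<C>. C \<inter> N \<noteq> {}} \<and> card {C \<in> \<C>. C \<inter> N \<noteq> {}} \<le> 2"
    unfolding \<C>_def by (rule components_meeting_hypersurface_neighbourhood [OF X N(1,3) U W])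
  have all_or_none: "Y \<subseteq> X closure_of C \<or> X closure_of C \<inter> Y = {}" if "C \<in> \<C>" for C
  proof -
    have "openin (subtopology X Y) (X closure_of C \<inter> Y)"
      using closure_of_component_openin_hypersurface [OF X Y] that by (simp add: \<C>_def)
    moreover have "closedin (subtopology X Y) (X closure_of C \<inter> Y)"
      using closedin_closure_of closedin_subtopology by blast
    ultimately have "X closure_of C \<inter> Y = {} \<or> X closure_of C \<inter> Y = Y"
      using conY topY unfolding connected_space_clopen_in by metis
    then show ?thesis
      by blast
  qed
  have clo: "X closure_of C \<inter> (topspace X - Y) = C" if "C \<in> \<C>" for C
    using closure_of_component_Int [of C X "topspace X - Y"] that by (simp add: \<C>_def)
  obtain A where A: "A \<in> \<C>" "y \<in> X closure_of A"
    using hypersurface_in_closure_of_component [OF X Y \<open>m > 0\<close> N(1,2) y] M unfolding \<C>_def by blast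
  then have "Y \<subseteq> X closure_of A"
    using all_or_none y by blast
  \<comment> \<open>Since \<open>Y\<close> may fail to be closed, its whole closure has to be
    controlled: outside \<open>Y\<close>, its points all belong to \<open>A\<close>.\<close>
  then have clYA: "X closure_of Y \<subseteq> X closure_of A"
    by (simp add: closure_of_minimal)
  have "C \<inter> N \<noteq> {}" if C: "C \<in> \<C>" for C
  proof -
    have "y \<in> X closure_of C"
    proof (rule ccontr)
      assume "y \<notin> X closure_of C"
      then have "X closure_of C \<inter> Y = {}"
        using all_or_none [OF C] y by blast
      then have "X closure_of C = C"
        using clo [OF C] closure_of_subset_topspace [of X C] by blast
      then have "closedin X C"
        using closedin_closure_of by metis
      have "C \<noteq> A"
        using A \<open>y \<notin> X closure_of C\<close> by blast
      then have "disjnt C A"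
        using pairwise_disjoint_connected_components_of C A(1) unfolding \<C>_def by (metis pairwiseD)
      have CX: "C \<subseteq> topspace X - Y"
        using clo [OF C] by blast
      \<comment> \<open>A component \<open>C\<close> other than \<open>A\<close> thus stays away
        from the closure of \<open>Y\<close>. It lies in the open complement of that closure and is
        therefore open in \<open>X\<close>; being closed too, it contradicts the connectedness of
        \<open>X\<close>.\<close>
      have "C \<inter> X closure_of Y = {}"
        using clo [OF A(1)] clYA CX \<open>disjnt C A\<close> by (auto simp: disjnt_iff)
      then have "C \<inter> (topspace X - X closure_of Y) = C"
        using CX by blast
      moreover have "openin X (C \<inter> (topspace X - X closure_of Y))"
      proof (rule openin_component_Int [OF X])
        show "topspace X - X closure_of Y \<subseteq> topspace X - Y"
          using closure_of_subset [OF YX] by blast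
        show "C \<in> connected_components_of (subtopology X (topspace X - Y))"
          using C by (simp add: \<C>_def)
      qed auto
      ultimately have "openin X C"
        by simp
      then have "C = {} \<or> C = topspace X"
        using conX \<open>closedin X C\<close> unfolding connected_space_clopen_in by metis
      moreover have "C \<noteq> {}" "A \<noteq> {}" "A \<subseteq> topspace X"
        using nonempty_connected_components_of C A(1) clo [OF A(1)] unfolding \<C>_def by blast+
      ultimately show False
        using \<open>disjnt C A\<close> by (auto simp: disjnt_iff)
    qed
    then show ?thesis
      using N by (auto simp: in_closure_of)
  qed
  then have "{C \<in> \<C>. C \<inter> N \<noteq> {}} = \<C>"
    by blast
  then show ?thesis
    using M by simp
qed

theorem corollary3:
  fixes n :: nat and X :: "'a topology" and Y :: "'a set"
  assumes "n > 1"
    and "topological_manifold n X"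
    and "submanifold (n - 1) Y X"
  shows "(\<forall>C \<in> connected_components_of (subtopology X (topspace X - Y)).
            \<exists>\<K> \<subseteq> connected_components_of (subtopology X Y). X closure_of C \<inter> Y = \<Union>\<K>)
       \<and> (connected_space X \<and> connected_space (subtopology X Y) \<longrightarrow>
            finite (connected_components_of (subtopology X (topspace X - Y))) \<and>
            card (connected_components_of (subtopology X (topspace X - Y))) \<le> 2)"
proof -
  obtain m where n: "n = Suc m" "m > 0"
    using \<open>n > 1\<close> by (metis One_nat_def Suc_less_eq less_imp_Suc_add plus_1_eq_Suc zero_less_Suc add_Suc)
  have X: "topological_manifold (Suc m) X" and Y: "submanifold m Y X"
    using assms n by simp_all
  show ?thesis
  proof (intro conjI ballI impI)
    fix C
    assume C: "C \<in> connected_components_of (subtopology X (topspace X - Y))"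
    show "\<exists>\<K> \<subseteq> connected_components_of (subtopology X Y). X closure_of C \<inter> Y = \<Union>\<K>"
    proof (rule clopen_eq_Union_components)
      show "openin (subtopology X Y) (X closure_of C \<inter> Y)"
        by (rule closure_of_component_openin_hypersurface [OF X Y C])
      show "closedin (subtopology X Y) (X closure_of C \<inter> Y)"
        using closedin_closure_of closedin_subtopology by blast
    qed
  qed (use connected_hypersurface_complement_components [OF X Y n(2)] in blast)+
qed

end
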